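(* Let $s,t$ be positive integers, let $\varepsilon\in\{1,-1\}$, and let \[ m=\frac{(s^4t+\varepsilon)^4-1}{s^4} \] be a square free integer with $m>1$ and $m\equiv 2,3 \pmod 4$. Let $\alpha=\sqrt[4]{m}$ and $K=\mathbb{Q}(\alpha)$. Then, up to equivalence, the only generators of power integral bases in $K$ are the elements $\vartheta=x\alpha+y\alpha^2+z\alpha^3$ with \[ (x,y,z)=(1,0,0)\quad\text{or}\quad (x,y,z)=\big((s^4t+\varepsilon)^2,\ \pm(s^4t+\varepsilon)s,\ s^2\big). \]
   Context: For a number field $K$ of degree $n$ with ring of integers $\mathbb{Z}_K$, an element $\gamma\in\mathbb{Z}_K$ generates a power integral basis if $\{1,\gamma,\ldots,\gamma^{n-1}\}$ is an integral basis of $K$. Two elements $\beta,\gamma\in\mathbb{Z}_K$ are called equivalent if $\beta+\gamma\in\mathbb{Z}$ or $\beta-\gamma\in\mathbb{Z}$; generators are considered only up to this equivalence. For $m$ square free with $m\equiv 2,3\pmod 4$, $\{1,\alpha,\alpha^2,\alpha^3\}$ is an integral basis of $K$. *)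

theory Defs
  imports Complex_Main
    "HOL-Computational_Algebra.Polynomial"
    "HOL-Computational_Algebra.Squarefree"
    "HOL-Number_Theory.Cong"
begin

definition is_subfield :: "'a::field_char_0 set \<Rightarrow> bool" where
  "is_subfield F \<longleftrightarrow> 1 \<in> F \<and> (\<forall>x\<in>F. \<forall>y\<in>F. x - y \<in> F \<and> x * y \<in> F) \<and> (\<forall>x\<in>F. inverse x \<in> F)"

(* The ambient field has characteristic 0, so every subfield contains the rationals and
   the least subfield containing a is Q(a). *)
definition adjoin :: "'a::field_char_0 \<Rightarrow> 'a set" where
  "adjoin a = is_subfield hull {a}"

lemma vector_space_rat: "vector_space (\<lambda>(q::rat) (x::'a::field_char_0). of_rat q * x)"
  by unfold_locales (auto simp: algebra_simps of_rat_add of_rat_mult)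

(* The degree [K : Q]; it is 0 when K has infinite dimension over Q. *)
definition field_degree :: "'a::field_char_0 set \<Rightarrow> nat" where
  "field_degree K = vector_space.dim (\<lambda>(q::rat) (x::'a). of_rat q * x) K"

definition ring_of_integers :: "'a::field_char_0 set \<Rightarrow> 'a set" where
  "ring_of_integers K = {x \<in> K. algebraic_int x}"

lemma module_int: "module (\<lambda>(k::int) (x::'a::ring_1). of_int k * x)"
  by unfold_locales (auto simp: algebra_simps)

definition integral_basis :: "'a::field_char_0 set \<Rightarrow> 'a set \<Rightarrow> bool" where
  "integral_basis K B \<longleftrightarrow>
     module.independent (\<lambda>(k::int) (x::'a). of_int k * x) B \<and>
     module.span (\<lambda>(k::int) (x::'a). of_int k * x) B = ring_of_integers K"

(* Repeated powers collapse in the image set, but then it has fewer than [K : Q]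
   elements and is not an integral basis of the number field K anyway. *)
definition generates_power_integral_basis :: "'a::field_char_0 set \<Rightarrow> 'a \<Rightarrow> bool" where
  "generates_power_integral_basis K \<gamma> \<longleftrightarrow>
     \<gamma> \<in> ring_of_integers K \<and> integral_basis K ((\<lambda>i. \<gamma> ^ i) ` {..<field_degree K})"

definition pib_equivalent :: "'a::field_char_0 set \<Rightarrow> 'a \<Rightarrow> 'a \<Rightarrow> bool" where
  "pib_equivalent K \<beta> \<gamma> \<longleftrightarrow>
     \<beta> \<in> ring_of_integers K \<and> \<gamma> \<in> ring_of_integers K \<and> (\<beta> + \<gamma> \<in> \<int> \<or> \<beta> - \<gamma> \<in> \<int>)"

end

theory Submission
  imports Defs
    "HOL-Number_Theory.Number_Theory"
    "HOL-Computational_Algebra.Nth_Powers"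
    "Jordan_Normal_Form.Char_Poly"
begin

text \<open>With \<open>\<beta> = x\<alpha> + y\<alpha>\<^sup>2 + z\<alpha>\<^sup>3\<close> the determinant of \<open>\<beta>, \<beta>\<^sup>2, \<beta>\<^sup>3\<close> with respect to
  \<open>\<alpha>, \<alpha>\<^sup>2, \<alpha>\<^sup>3\<close> is \<open>N (N\<^sup>2 + 4m(y\<^sup>2 - xz)\<^sup>2)\<close> with \<open>N = x\<^sup>2 - mz\<^sup>2\<close>. As \<open>m \<equiv> 3\<close> modulo \<open>4\<close>, it is a unit only if
  \<open>N = 1\<close> and \<open>y\<^sup>2 = xz\<close>, which makes \<open>x\<close> and \<open>z\<close> squares up to a common sign and leaves the Thue
  equation \<open>a\<^sup>4 - mb\<^sup>4 = 1\<close>. It has the solution \<open>(c, s)\<close> with \<open>c = s\<^sup>4t + \<epsilon>\<close>, and \<open>c\<close> is even.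

  Since \<open>s\<^sup>4 < 4m\<close>, the pair \<open>(c\<^sup>2, s\<^sup>2)\<close> is the fundamental solution of \<open>X\<^sup>2 - mY\<^sup>2 = 1\<close>. Any
  solution \<open>(a, b)\<close> therefore has \<open>a\<^sup>2 = T n\<close> and \<open>b\<^sup>2 = s\<^sup>2 U n\<close>, where \<open>T n\<close> and \<open>U n\<close> are the Chebyshev
  sequences at \<open>c\<^sup>2\<close> (with \<open>U 1 = 1\<close>), so that \<open>T n\<close> and \<open>U n\<close> are both squares. Even \<open>n\<close> are excluded by descent.
  For odd \<open>n > 1\<close> let \<open>p\<close> be a prime divisor of \<open>n\<close>, \<open>r = n / p\<close> and \<open>C = T r\<close>. If \<open>p\<close> does not
  divide \<open>U r\<close>, then the factor \<open>U\<^sub>p(C)\<close> of \<open>U n\<close> is a square. But at an even argument the values of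
  \<open>U\<close> with odd index satisfy the same congruences and the same reciprocity law as the indices, so their
  Jacobi symbol is that of the indices, and an index that is a nonresidue modulo \<open>p\<close> gives a contradiction.
  If \<open>p\<close> divides \<open>U r\<close>, then \<open>p\<close> divides \<open>C\<^sup>2 - 1\<close> and \<open>C = d\<^sup>2\<close> is a square, so \<open>p \<le> d\<^sup>2 + 1\<close>.
  On the other hand \<open>T\<^sub>p(d\<^sup>2)\<close> is a square, which forces \<open>p \<ge> d\<^sup>2 + 2\<close>.\<close>

section \<open>Chebyshev polynomials and Pell equations\<close>

text \<open>With the usual Chebyshev polynomials, \<open>cheb_U x n\<close> is \<open>U\<^sub>n\<^sub>-\<^sub>1(x)\<close>: then
  \<open>(x + \<surd>(x\<^sup>2 - 1)) ^ n = cheb_T x n + cheb_U x n * \<surd>(x\<^sup>2 - 1)\<close>.\<close>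

fun cheb_T cheb_U :: "int \<Rightarrow> nat \<Rightarrow> int" where
  "cheb_T x 0 = 1"
| "cheb_T x (Suc n) = x * cheb_T x n + (x\<^sup>2 - 1) * cheb_U x n"
| "cheb_U x 0 = 0"
| "cheb_U x (Suc n) = cheb_T x n + x * cheb_U x n"

lemma cheb_add:
  "cheb_T x (m + n) = cheb_T x m * cheb_T x n + (x\<^sup>2 - 1) * cheb_U x m * cheb_U x n \<and>
   cheb_U x (m + n) = cheb_U x m * cheb_T x n + cheb_T x m * cheb_U x n"
proof (induction n)
  case (Suc n)
  show ?case
    unfolding add_Suc_right cheb_T.simps cheb_U.simps Suc[THEN conjunct1] Suc[THEN conjunct2]
    by (simp add: algebra_simps power2_eq_square)
qed simp

lemmas cheb_T_add = cheb_add[THEN conjunct1]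
lemmas cheb_U_add = cheb_add[THEN conjunct2]

lemma cheb_pell: "(cheb_T x n)\<^sup>2 - (x\<^sup>2 - 1) * (cheb_U x n)\<^sup>2 = 1"
proof (induction n)
  case (Suc n)
  have "(cheb_T x (Suc n))\<^sup>2 - (x\<^sup>2 - 1) * (cheb_U x (Suc n))\<^sup>2
      = (cheb_T x n)\<^sup>2 - (x\<^sup>2 - 1) * (cheb_U x n)\<^sup>2"
    by (simp add: algebra_simps power2_eq_square)
  with Suc show ?case by simp
qed simp

lemma cheb_T_double: "cheb_T x (2 * n) = 2 * (cheb_T x n)\<^sup>2 - 1"
proof -
  have "cheb_T x (2 * n) = (cheb_T x n)\<^sup>2 + (x\<^sup>2 - 1) * (cheb_U x n)\<^sup>2"
    unfolding mult_2 cheb_T_add by (simp add: power2_eq_square)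
  then show ?thesis using cheb_pell[of x n] by linarith
qed

lemma cheb_U_double: "cheb_U x (2 * n) = 2 * cheb_T x n * cheb_U x n"
  unfolding mult_2[of n] cheb_U_add by simp

text \<open>The \<open>m\<close>-th power of \<open>x + sqrt (x^2 - 1)\<close> is again a unit of
  this form, now at \<open>cheb_T x m\<close>, so multiplying indices means composing. This supplies
  the factorisation of \<open>cheb_U x (r * p)\<close>.\<close>

lemma cheb_mult:
  "cheb_T x (m * n) = cheb_T (cheb_T x m) n \<and>
   cheb_U x (m * n) = cheb_U x m * cheb_U (cheb_T x m) n"
proof (induction n)
  case (Suc n)
  have p: "(x\<^sup>2 - 1) * (cheb_U x m)\<^sup>2 = (cheb_T x m)\<^sup>2 - 1"
    using cheb_pell[of x m] by simp
  have e: "m * Suc n = m + m * n" by simp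
  have "cheb_T x (m * Suc n) = cheb_T x m * cheb_T (cheb_T x m) n
      + ((x\<^sup>2 - 1) * (cheb_U x m)\<^sup>2) * cheb_U (cheb_T x m) n"
    unfolding e cheb_T_add Suc[THEN conjunct1] Suc[THEN conjunct2]
    by (simp add: power2_eq_square)
  moreover have "cheb_U x (m * Suc n) = cheb_U x m * cheb_U (cheb_T x m) (Suc n)"
    unfolding e cheb_U_add Suc[THEN conjunct1] Suc[THEN conjunct2]
    by (simp add: distrib_left)
  ultimately show ?case unfolding p by simp
qed simp

lemmas cheb_T_mult = cheb_mult[THEN conjunct1]
lemmas cheb_U_mult = cheb_mult[THEN conjunct2]

lemma cheb_coprime: "coprime (cheb_T x n) (cheb_U x n)"
proof (rule coprimeI)
  fix d assume "d dvd cheb_T x n" "d dvd cheb_U x n"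
  then have "d dvd (cheb_T x n)\<^sup>2 - (x\<^sup>2 - 1) * (cheb_U x n)\<^sup>2"
    by (simp add: power2_eq_square)
  then show "is_unit d" by (simp add: cheb_pell)
qed

lemma cheb_T_2: "cheb_T x 2 = 2 * x\<^sup>2 - 1"
  by (simp add: numeral_2_eq_2 power2_eq_square)

lemma cheb_U_2: "cheb_U x 2 = 2 * x"
  by (simp add: numeral_2_eq_2)

lemma cheb_add_2:
  "cheb_T x (n + 2) = cheb_T x n * (2 * x\<^sup>2 - 1) + (x\<^sup>2 - 1) * cheb_U x n * (2 * x)"
  "cheb_U x (n + 2) = cheb_U x n * (2 * x\<^sup>2 - 1) + cheb_T x n * (2 * x)"
  by (simp_all only: cheb_T_add cheb_U_add cheb_T_2 cheb_U_2)

text \<open>At an odd index \<open>cheb_T\<close> is an odd and \<open>cheb_U\<close> an even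
  polynomial in \<open>x\<close>, so modulo \<open>x^2\<close> only the linear and the constant term
  survive.\<close>

lemma odd_cheb_cong_sq:
  "x\<^sup>2 dvd cheb_T x (2 * k + 1) - (-1) ^ k * (2 * int k + 1) * x \<and>
   x\<^sup>2 dvd cheb_U x (2 * k + 1) - (-1) ^ k"
proof (induction k)
  case (Suc k)
  from Suc obtain a b where
    a: "cheb_T x (2 * k + 1) = (-1) ^ k * (2 * int k + 1) * x + x\<^sup>2 * a" and
    b: "cheb_U x (2 * k + 1) = (-1) ^ k + x\<^sup>2 * b"
    unfolding dvd_def by (auto simp: algebra_simps)
  have e: "2 * Suc k + 1 = (2 * k + 1) + 2" by simp
  have "cheb_T x (2 * Suc k + 1) - (-1) ^ Suc k * (2 * int (Suc k) + 1) * x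
     = x\<^sup>2 * (2 * (-1) ^ k * (2 * int k + 1) * x + a * (2 * x\<^sup>2 - 1) + 2 * x * (-1) ^ k + 2 * x * b * (x\<^sup>2 - 1))"
    unfolding e cheb_add_2 a b by (simp add: algebra_simps power2_eq_square)
  moreover have "cheb_U x (2 * Suc k + 1) - (-1) ^ Suc k
     = x\<^sup>2 * (2 * (-1) ^ k + b * (2 * x\<^sup>2 - 1) + 2 * (-1) ^ k * (2 * int k + 1) + 2 * x * a)"
    unfolding e cheb_add_2 a b by (simp add: algebra_simps power2_eq_square)
  ultimately show ?case by simp
qed simp

text \<open>Modulo \<open>x^2 - 1\<close> the adjoined root squares to 0 and \<open>x\<close>
  squares to 1, so the \<open>n\<close>-th power has the parts \<open>x ^ n\<close> and
  \<open>n * x ^ (n - 1)\<close>.\<close>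

lemma odd_cheb_cong_sq_minus_1:
  "x\<^sup>2 - 1 dvd cheb_T x (2 * k + 1) - x \<and> x\<^sup>2 - 1 dvd cheb_U x (2 * k + 1) - (2 * int k + 1)"
proof (induction k)
  case (Suc k)
  from Suc obtain a b where
    a: "cheb_T x (2 * k + 1) = x + (x\<^sup>2 - 1) * a" and
    b: "cheb_U x (2 * k + 1) = 2 * int k + 1 + (x\<^sup>2 - 1) * b"
    unfolding dvd_def by (auto simp: algebra_simps)
  have e: "2 * Suc k + 1 = (2 * k + 1) + 2" by simp
  have "cheb_T x (2 * Suc k + 1) - x
     = (x\<^sup>2 - 1) * (2 * x + a * (2 * x\<^sup>2 - 1) + cheb_U x (2 * k + 1) * (2 * x))"
    unfolding e cheb_add_2 a by (simp add: algebra_simps power2_eq_square)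
  moreover have "cheb_U x (2 * Suc k + 1) - (2 * int (Suc k) + 1)
     = (x\<^sup>2 - 1) * (2 * (2 * int k + 1) + b * (2 * x\<^sup>2 - 1) + 2 * x * a + 2)"
    unfolding e cheb_add_2 a b by (simp add: algebra_simps power2_eq_square)
  ultimately show ?case by simp
qed simp

text \<open>At \<open>x = 1\<close> the recurrences produce the constant 1 and the index itself,
  whatever its parity.\<close>

lemma cheb_U_cong_minus_1:
  "x - 1 dvd cheb_T x n - 1 \<and> x - 1 dvd cheb_U x n - int n"
proof (induction n)
  case (Suc n)
  from Suc obtain a b where
    a: "cheb_T x n = 1 + (x - 1) * a" and b: "cheb_U x n = int n + (x - 1) * b"
    unfolding dvd_def by (auto simp: algebra_simps)
  have "cheb_T x (Suc n) - 1 = (x - 1) * (1 + x * a + (x + 1) * cheb_U x n)"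
    unfolding cheb_T.simps a by (simp add: algebra_simps power2_eq_square)
  moreover have "cheb_U x (Suc n) - int (Suc n) = (x - 1) * (a + int n + x * b)"
    unfolding cheb_U.simps a b by (simp add: algebra_simps)
  ultimately show ?case by simp
qed simp

text \<open>A half-angle formula: for \<open>x = cosh u\<close> the left side and
  \<open>x - 1\<close> are both twice the square of a hyperbolic sine. Taken at \<open>x^2\<close>,
  it turns a square value of \<open>cheb_T\<close> into a solution of the Pell equation for
  \<open>x^2 - 1\<close>.\<close>

lemma cheb_T_odd_minus_1:
  "cheb_T x (2 * k + 1) - 1 = (x - 1) * (cheb_U x (Suc k) + cheb_U x k)\<^sup>2"
proof -
  have "cheb_T x (2 * k + 1) = cheb_T x (k + Suc k)" by (simp add: mult_2)
  also have "\<dots> = x * (cheb_T x k)\<^sup>2 + 2 * (x\<^sup>2 - 1) * cheb_T x k * cheb_U x k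
      + x * (x\<^sup>2 - 1) * (cheb_U x k)\<^sup>2"
    by (simp only: cheb_T_add cheb_T.simps cheb_U.simps) (simp add: algebra_simps power2_eq_square)
  finally have "cheb_T x (2 * k + 1) - 1 - (x - 1) * (cheb_U x (Suc k) + cheb_U x k)\<^sup>2
     = (cheb_T x k)\<^sup>2 - (x\<^sup>2 - 1) * (cheb_U x k)\<^sup>2 - 1"
    by (simp add: algebra_simps power2_eq_square)
  then show ?thesis using cheb_pell[of x k] by simp
qed

text \<open>Going two indices at a time replaces \<open>x\<close> by \<open>cheb_T x 2\<close>. The
  result has the same shape as the root in \<open>cheb_T_odd_minus_1\<close>, so the two can be
  compared by size.\<close>

lemma cheb_U_odd_eq:
  "cheb_U x (2 * k + 1) = cheb_U (2 * x\<^sup>2 - 1) (Suc k) + cheb_U (2 * x\<^sup>2 - 1) k"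
proof -
  have u: "cheb_U x (2 * n) = 2 * x * cheb_U (2 * x\<^sup>2 - 1) n"
   and t: "cheb_T x (2 * n) = cheb_T (2 * x\<^sup>2 - 1) n" for n
    using cheb_U_mult[of x 2 n] cheb_T_mult[of x 2 n] by (simp_all add: cheb_T_2 cheb_U_2)
  show ?thesis
    by (simp add: u t) (simp add: algebra_simps power2_eq_square)
qed

lemma cheb_pos: "x \<ge> 1 \<Longrightarrow> cheb_T x n \<ge> 1 \<and> cheb_U x n \<ge> 0"
proof (induction n)
  case (Suc n)
  have "x * cheb_T x n \<ge> 1 * 1" using Suc by (intro mult_mono) auto
  moreover have "(x\<^sup>2 - 1) * cheb_U x n \<ge> 0" using Suc by simp
  moreover have "x * cheb_U x n \<ge> 0" using Suc by simp
  ultimately show ?case using Suc unfolding cheb_T.simps cheb_U.simps by linarith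
qed simp

lemma cheb_U_pos:
  assumes "x \<ge> 1" "n > 0"
  shows "cheb_U x n > 0"
proof -
  obtain k where n: "n = Suc k" using assms(2) by (cases n) auto
  have "x * cheb_U x k \<ge> 0" "cheb_T x k \<ge> 1" using cheb_pos[OF assms(1), of k] assms by auto
  then show ?thesis by (simp add: n)
qed

lemma strict_mono_cheb_U: assumes "x \<ge> 1" shows "strict_mono (cheb_U x)"
proof (rule strict_mono_Suc_iff[THEN iffD2], intro allI)
  fix n
  have "cheb_U x n \<le> x * cheb_U x n"
    using cheb_pos[OF assms, of n] assms by (simp add: mult_le_cancel_right1)
  then show "cheb_U x n < cheb_U x (Suc n)"
    using cheb_pos[OF assms, of n] by simp
qed

lemma cheb_mono:
  assumes "1 \<le> x" "x \<le> y"
  shows "cheb_T x n \<le> cheb_T y n \<and> cheb_U x n \<le> cheb_U y n"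
proof (induction n)
  case (Suc n)
  have "x\<^sup>2 \<le> y\<^sup>2" using assms by (auto intro: power_mono)
  moreover have "y\<^sup>2 \<ge> 1" using assms by auto
  moreover have "cheb_U x n \<le> cheb_U y n" "cheb_U x n \<ge> 0"
    using Suc cheb_pos[of x n] assms by auto
  ultimately have "(x\<^sup>2 - 1) * cheb_U x n \<le> (y\<^sup>2 - 1) * cheb_U y n"
    by (intro mult_mono) linarith+
  moreover have "x * cheb_T x n \<le> y * cheb_T y n" "x * cheb_U x n \<le> y * cheb_U y n"
    using Suc cheb_pos[of x n] assms by (auto intro!: mult_mono)
  ultimately show ?case using Suc by simp
qed simp

lemma cheb_U_strict_mono_arg:
  assumes "1 \<le> x" "x < y" "n \<ge> 2"
  shows "cheb_U x n < cheb_U y n"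
proof -
  obtain k where n: "n = Suc k" "k \<ge> 1" using assms(3) by (cases n) auto
  have "cheb_U x k > 0" using assms n by (intro cheb_U_pos) auto
  then have "x * cheb_U x k < y * cheb_U x k" using assms by simp
  also have "\<dots> \<le> y * cheb_U y k"
    using cheb_mono[of x y k] assms by (intro mult_left_mono) auto
  finally show ?thesis using cheb_mono[of x y k] assms n by simp
qed

section \<open>Pell equations: descent to powers of the fundamental solution\<close>

lemma pell_solutions:
  fixes D u v :: int
  assumes "D > 0" "u > 0" "v > 0" and uv: "u\<^sup>2 - D * v\<^sup>2 = 1"
    and min: "\<And>x y. x > 0 \<Longrightarrow> y > 0 \<Longrightarrow> x\<^sup>2 - D * y\<^sup>2 = 1 \<Longrightarrow> v \<le> y"
  assumes "x > 0" "y \<ge> 0" "x\<^sup>2 - D * y\<^sup>2 = 1"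
  shows "\<exists>n. x = cheb_T u n \<and> y = v * cheb_U u n"
  using assms(6-)
proof (induction "nat y" arbitrary: x y rule: less_induct)
  case less
  show ?case
  proof (cases "y = 0")
    case True
    then have "x = 1" using less.prems by (auto simp: power2_eq_1_iff)
    with True show ?thesis by (intro exI[of _ 0]) simp
  next
    case False
    then have y: "y > 0" using less.prems by simp
    with less.prems min have vy: "v \<le> y" by blast
    \<comment> \<open>The solution divided by the minimal one: \<open>x + y * sqrt D\<close> times
      the conjugate \<open>u - v * sqrt D\<close>. The estimates below give \<open>0 < x'\<close>
      and \<open>0 \<le> y' < y\<close>; minimality enters through \<open>v \<le> y\<close>, which
      yields \<open>0 \<le> y'\<close>.\<close>
    define x' where "x' = u * x - D * v * y"
    define y' where "y' = u * y - v * x"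
    have ue: "u\<^sup>2 = 1 + D * v\<^sup>2" and xe: "x\<^sup>2 = 1 + D * y\<^sup>2" using uv less.prems by auto
    have "x'\<^sup>2 - D * y'\<^sup>2 = (u\<^sup>2 - D * v\<^sup>2) * (x\<^sup>2 - D * y\<^sup>2)"
      unfolding x'_def y'_def by (simp add: algebra_simps power2_eq_square)
    then have p': "x'\<^sup>2 - D * y'\<^sup>2 = 1" using uv less.prems by simp
    have "(u * x)\<^sup>2 - (D * v * y)\<^sup>2 = 1 + D * v\<^sup>2 + D * y\<^sup>2"
      unfolding power_mult_distrib ue xe by (simp add: algebra_simps power2_eq_square)
    moreover have "D * v\<^sup>2 \<ge> 0" "D * y\<^sup>2 \<ge> 0" using assms(1) by auto
    ultimately have "(D * v * y)\<^sup>2 < (u * x)\<^sup>2" by linarith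
    then have "D * v * y < u * x"
      by (rule power2_less_imp_less) (use less.prems assms in simp)
    then have x': "x' > 0" unfolding x'_def by simp
    have "(u * y)\<^sup>2 - (v * x)\<^sup>2 = y\<^sup>2 - v\<^sup>2"
      unfolding power_mult_distrib ue xe by (simp add: algebra_simps power2_eq_square)
    moreover have "v\<^sup>2 \<le> y\<^sup>2" using vy assms by (intro power_mono) auto
    ultimately have "(v * x)\<^sup>2 \<le> (u * y)\<^sup>2" by linarith
    then have "v * x \<le> u * y"
      by (rule power2_le_imp_le) (use y assms in simp)
    then have y': "y' \<ge> 0" unfolding y'_def by simp
    have "(v * x)\<^sup>2 - ((u - 1) * y)\<^sup>2 = v\<^sup>2 + y\<^sup>2 * (2 * u - 2) + y\<^sup>2 * (1 + D * v\<^sup>2 - u\<^sup>2)"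
      unfolding power_mult_distrib xe by (simp add: algebra_simps power2_eq_square)
    then have "(v * x)\<^sup>2 - ((u - 1) * y)\<^sup>2 = v\<^sup>2 + y\<^sup>2 * (2 * u - 2)" using ue by simp
    moreover have "y\<^sup>2 * (2 * u - 2) \<ge> 0" "v\<^sup>2 > 0" using assms by auto
    ultimately have "((u - 1) * y)\<^sup>2 < (v * x)\<^sup>2" by linarith
    then have "(u - 1) * y < v * x"
      by (rule power2_less_imp_less) (use less.prems assms in simp)
    then have "y' < y" unfolding y'_def by (simp add: algebra_simps)
    then obtain n where n: "x' = cheb_T u n" "y' = v * cheb_U u n"
      using less.hyps[of y' x'] x' y' y p' by auto
    \<comment> \<open>Multiplying back by \<open>u + v * sqrt D\<close> recovers
      \<open>(x, y)\<close> and raises the index by one.\<close>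
    have "u * x' + D * v * y' = x * (u\<^sup>2 - D * v\<^sup>2)" "u * y' + v * x' = y * (u\<^sup>2 - D * v\<^sup>2)"
      unfolding x'_def y'_def by (simp_all add: algebra_simps power2_eq_square)
    then have "x = u * x' + D * v * y'" "y = u * y' + v * x'" using uv by auto
    then have "x = cheb_T u (Suc n) \<and> y = v * cheb_U u (Suc n)"
      unfolding n using ue by (simp add: algebra_simps power2_eq_square)
    then show ?thesis by blast
  qed
qed

section \<open>The Jacobi symbol\<close>

lemma Legendre_cases: "Legendre a p \<in> {-1, 0, 1}"
  by (simp add: Legendre_def)

text \<open>Euler's criterion gives only a congruence; for \<open>p > 2\<close> the three values of
  the symbol are distinct modulo \<open>p\<close>, so it becomes an equality.\<close>

lemma eq_if_cong_Legendre_values: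
  fixes x y p :: int
  assumes "[x = y] (mod p)" "x \<in> {-1, 0, 1}" "y \<in> {-1, 0, 1}" "p > 2"
  shows "x = y"
proof -
  have "p dvd x - y" using assms(1) by (simp add: cong_iff_dvd_diff)
  moreover have "\<bar>x - y\<bar> < p" using assms by auto
  ultimately show ?thesis using dvd_imp_le_int[of "x - y" p] by auto
qed

lemma prime_int_gt_2:
  fixes p :: int
  assumes "prime p" "odd p"
  shows "p > 2"
  using assms prime_ge_2_int[of p] by (cases "p = 2") auto

lemma Legendre_euler:
  fixes p :: int
  assumes "prime p" "odd p"
  shows "[Legendre a p = a ^ nat ((p - 1) div 2)] (mod p)"
proof -
  have p2: "p > 2" using prime_int_gt_2[OF assms] .
  have "prime (nat p)" using assms(1) prime_int_nat_transfer[of p] by blast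
  then have "[Legendre a (int (nat p)) = a ^ ((nat p - 1) div 2)] (mod int (nat p))"
    using p2 by (intro euler_criterion) auto
  moreover have "(nat p - 1) div 2 = nat ((p - 1) div 2)" "int (nat p) = p" using p2 by linarith+
  ultimately show ?thesis by (simp only:)
qed

lemma Legendre_mult:
  fixes p :: int
  assumes "prime p" "odd p"
  shows "Legendre (a * b) p = Legendre a p * Legendre b p"
proof (rule eq_if_cong_Legendre_values)
  have "[Legendre (a * b) p = a ^ nat ((p - 1) div 2) * b ^ nat ((p - 1) div 2)] (mod p)"
    using Legendre_euler[OF assms, of "a * b"] by (simp add: power_mult_distrib)
  moreover have "[Legendre a p * Legendre b p = a ^ nat ((p - 1) div 2) * b ^ nat ((p - 1) div 2)] (mod p)"
    using Legendre_euler[OF assms] by (intro cong_mult)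
  ultimately show "[Legendre (a * b) p = Legendre a p * Legendre b p] (mod p)"
    by (rule cong_trans[OF _ cong_sym])
  show "Legendre a p * Legendre b p \<in> {-1, 0, 1}"
    using Legendre_cases[of a p] Legendre_cases[of b p] by auto
qed (use Legendre_cases prime_int_gt_2[OF assms] in auto)

lemma Legendre_cong: "[a = b] (mod p) \<Longrightarrow> Legendre a p = Legendre b p"
  by (simp add: Legendre_def QuadRes_def cong_def)

lemma Legendre_minus_one:
  fixes p :: int
  assumes "prime p" "odd p"
  shows "Legendre (-1) p = (if p mod 4 = 1 then 1 else -1)"
proof (rule eq_if_cong_Legendre_values)
  have "even ((p - 1) div 2) \<longleftrightarrow> p mod 4 = 1" using assms(2) by presburger
  then have "(-1) ^ nat ((p - 1) div 2) = (if p mod 4 = 1 then 1 else -1 :: int)"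
    using prime_int_gt_2[OF assms] by (simp add: minus_one_power_iff even_nat_iff)
  then show "[Legendre (-1) p = (if p mod 4 = 1 then 1 else -1)] (mod p)"
    using Legendre_euler[OF assms, of "-1"] by simp
qed (use Legendre_cases prime_int_gt_2[OF assms] in auto)

definition jacobi :: "int \<Rightarrow> int \<Rightarrow> int" where
  "jacobi a n = (\<Prod>p\<in>#prime_factorization n. Legendre a p)"

lemma jacobi_1 [simp]: "jacobi a 1 = 1"
  by (simp add: jacobi_def)

lemma jacobi_prime: "prime p \<Longrightarrow> jacobi a p = Legendre a p"
  by (simp add: jacobi_def prime_factorization_prime)

lemma jacobi_mult_right:
  "m \<noteq> 0 \<Longrightarrow> n \<noteq> 0 \<Longrightarrow> jacobi a (m * n) = jacobi a m * jacobi a n"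
  by (simp add: jacobi_def prime_factorization_mult)

text \<open>Builds an odd number one odd prime at a time, so that laws of the Legendre symbol pass
  to the Jacobi symbol.\<close>

lemma odd_pos_int_induct [consumes 2, case_names one factor]:
  fixes n :: int
  assumes "n > 0" "odd n" "P 1"
    and "\<And>p n. prime p \<Longrightarrow> odd p \<Longrightarrow> n > 0 \<Longrightarrow> odd n \<Longrightarrow> P n \<Longrightarrow> P (p * n)"
  shows "P n"
proof -
  have "n > 0 \<longrightarrow> odd n \<longrightarrow> P n"
  proof (induction n rule: prime_divisors_induct)
    case (unit x)
    then show ?case using assms(3) by auto
  next
    case (factor p x)
    then show ?case using assms(4)[of p x] prime_gt_0_int[of p] by (auto simp: zero_less_mult_iff)
  qed simp
  then show ?thesis using assms by simp
qed

lemma jacobi_factor: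
  "prime p \<Longrightarrow> n > 0 \<Longrightarrow> jacobi a (p * n) = Legendre a p * jacobi a n"
  by (simp add: jacobi_mult_right jacobi_prime)

lemma jacobi_cong:
  assumes "n > 0" "odd n" "[a = b] (mod n)"
  shows "jacobi a n = jacobi b n"
  using assms
proof (induction rule: odd_pos_int_induct)
  case (factor p n)
  have "[a = b] (mod p)" "[a = b] (mod n)"
    using factor.prems by (auto intro: cong_dvd_modulus)
  with factor show ?case by (simp add: jacobi_factor Legendre_cong[of a b p])
qed simp

lemma jacobi_mult_left:
  assumes "n > 0" "odd n"
  shows "jacobi (a * b) n = jacobi a n * jacobi b n"
  using assms by (induction rule: odd_pos_int_induct) (auto simp: jacobi_factor Legendre_mult)

lemma jacobi_one_left: "n > 0 \<Longrightarrow> odd n \<Longrightarrow> jacobi 1 n = 1"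
proof (induction rule: odd_pos_int_induct)
  case (factor p n)
  have "Legendre 1 p = 1"
    using factor(1) by (auto simp: Legendre_def QuadRes_def cong_iff_dvd_diff intro: exI[of _ 1])
  with factor show ?case by (simp add: jacobi_factor)
qed simp

lemma odd_mod_4: "odd (n::int) \<Longrightarrow> n mod 4 = 1 \<or> n mod 4 = 3"
  by presburger

text \<open>Multiplicativity of the quadratic character modulo 4; it carries the signs through the
  inductions below.\<close>

lemma mult_mod_4_eq_1_iff:
  assumes "odd (m::int)" "odd n"
  shows "(m * n) mod 4 = 1 \<longleftrightarrow> (m mod 4 = 1 \<longleftrightarrow> n mod 4 = 1)"
proof -
  have "(m * n) mod 4 = ((m mod 4) * (n mod 4)) mod 4" by (simp add: mod_mult_eq)
  then show ?thesis using odd_mod_4[OF assms(1)] odd_mod_4[OF assms(2)] by (elim disjE) simp_all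
qed

lemma jacobi_minus_one:
  "n > 0 \<Longrightarrow> odd n \<Longrightarrow> jacobi (-1) n = (if n mod 4 = 1 then 1 else -1)"
proof (induction rule: odd_pos_int_induct)
  case (factor p n)
  then show ?case by (auto simp: jacobi_factor Legendre_minus_one mult_mod_4_eq_1_iff)
qed simp

lemma jacobi_coprime:
  assumes "n > 0" "odd n" "coprime a n"
  shows "jacobi a n \<in> {-1, 1}"
  using assms
proof (induction rule: odd_pos_int_induct)
  case (factor p n)
  have "\<not> p dvd a"
    using factor.prems factor.hyps not_prime_unit[of p] by (meson coprime_common_divisor dvd_triv_left)
  then have "Legendre a p \<in> {-1, 1}"
    by (auto simp: Legendre_def cong_0_iff)
  with factor show ?case by (auto simp: jacobi_factor)
qed simp

lemma jacobi_square:
  assumes "n > 0" "odd n" "coprime a n"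
  shows "jacobi a (n\<^sup>2) = 1"
proof -
  have "jacobi a (n\<^sup>2) = jacobi a n * jacobi a n"
    using assms unfolding power2_eq_square by (intro jacobi_mult_right) auto
  then show ?thesis using jacobi_coprime[OF assms] by (elim insertE) auto
qed

lemma Legendre_reciprocity:
  fixes p q :: int
  assumes "prime p" "odd p" "prime q" "odd q" "p \<noteq> q"
  shows "Legendre p q = Legendre q p * (if p mod 4 = 1 \<or> q mod 4 = 1 then 1 else -1)"
proof -
  have g: "p > 2" "q > 2" using assms prime_int_gt_2 by auto
  have "Legendre p q * Legendre q p = (-1) ^ nat ((p - 1) div 2 * ((q - 1) div 2))"
    by (rule Quadratic_Reciprocity_int)
      (use assms g prime_int_nat_transfer[of p] prime_int_nat_transfer[of q] in blast)+
  also have "\<dots> = (if p mod 4 = 1 \<or> q mod 4 = 1 then 1 else -1)"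
  proof -
    have "even ((p - 1) div 2) \<longleftrightarrow> p mod 4 = 1" "even ((q - 1) div 2) \<longleftrightarrow> q mod 4 = 1"
      using assms by presburger+
    moreover have "(p - 1) div 2 * ((q - 1) div 2) \<ge> 0" using g by simp
    ultimately show ?thesis by (simp add: minus_one_power_iff even_nat_iff)
  qed
  finally have r: "Legendre p q * Legendre q p = (if p mod 4 = 1 \<or> q mod 4 = 1 then 1 else -1)" .
  then have "Legendre q p * Legendre q p = 1"
    using Legendre_cases[of q p] by (auto split: if_splits)
  moreover have "Legendre q p * (Legendre p q * Legendre q p)
      = Legendre p q * (Legendre q p * Legendre q p)" by (simp only: ac_simps)
  ultimately show ?thesis unfolding r by simp
qed

lemma jacobi_prime_reciprocity:
  assumes "n > 0" "odd n" "prime p" "odd p" "coprime p n"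
  shows "jacobi p n = jacobi n p * (if p mod 4 = 1 \<or> n mod 4 = 1 then 1 else -1)"
  using assms
proof (induction rule: odd_pos_int_induct)
  case (factor q n)
  have pq: "p \<noteq> q" using factor by auto
  have "jacobi (q * n) p = Legendre q p * jacobi n p"
    using factor prime_gt_0_int[of p] jacobi_mult_left[of p q n] by (simp add: jacobi_prime)
  moreover have "jacobi p (q * n) = Legendre p q * jacobi p n"
    using factor by (simp add: jacobi_factor)
  moreover have "Legendre p q = Legendre q p * (if p mod 4 = 1 \<or> q mod 4 = 1 then 1 else -1)"
    using Legendre_reciprocity[of p q] factor pq by simp
  ultimately show ?case
    using factor by (auto simp: mult_mod_4_eq_1_iff)
next
  case one
  then show ?case using prime_gt_0_int[of p] by (simp add: jacobi_one_left)
qed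

lemma jacobi_reciprocity:
  assumes "n > 0" "odd n" "m > 0" "odd m" "coprime m n"
  shows "jacobi m n = jacobi n m * (if m mod 4 = 1 \<or> n mod 4 = 1 then 1 else -1)"
  using assms(3,4,1,2,5)
proof (induction rule: odd_pos_int_induct)
  case (factor p m)
  have "jacobi (p * m) n = jacobi p n * jacobi m n" using factor by (simp add: jacobi_mult_left)
  moreover have "jacobi n (p * m) = jacobi n p * jacobi n m"
    using factor by (simp add: jacobi_factor jacobi_prime)
  moreover have "jacobi p n = jacobi n p * (if p mod 4 = 1 \<or> n mod 4 = 1 then 1 else -1)"
    using jacobi_prime_reciprocity[of n p] factor by simp
  ultimately show ?case
    using factor by (auto simp: mult_mod_4_eq_1_iff)
qed (simp add: jacobi_one_left)

section \<open>Squares in Chebyshev sequences\<close>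

lemma cheb_U_mod_4:
  assumes "even x"
  shows "cheb_U x (2 * k + 1) mod 4 = (if even k then 1 else 3)"
proof -
  have "4 dvd x\<^sup>2" using assms by (auto simp: power2_eq_square elim!: evenE)
  then have "4 dvd cheb_U x (2 * k + 1) - (-1) ^ k"
    using odd_cheb_cong_sq[of x k] by (meson dvd_trans)
  then show ?thesis by (auto simp: minus_one_power_iff) presburger+
qed

text \<open>Value and index therefore contribute the same sign, both in the symbol of -1 and in
  reciprocity.\<close>

lemma odd_cheb_U_mod_4_iff:
  assumes "even x" "odd n"
  shows "cheb_U x n mod 4 = 1 \<longleftrightarrow> int n mod 4 = 1"
proof -
  obtain k where n: "n = 2 * k + 1" using assms(2) by (elim oddE)
  have "int n mod 4 = 1 \<longleftrightarrow> even k" unfolding n by presburger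
  then show ?thesis unfolding n using cheb_U_mod_4[OF assms(1), of k] by simp
qed

lemma odd_cheb_U:
  assumes "even x" "odd n"
  shows "odd (cheb_U x n)"
proof -
  obtain k where n: "n = 2 * k + 1" using assms(2) by (elim oddE)
  show ?thesis unfolding n using cheb_U_mod_4[OF assms(1), of k] by presburger
qed

section \<open>Jacobi symbols of values and of indices\<close>

lemma cheb_U_shift: "cheb_U x n dvd cheb_U x (r + 2 * n) - cheb_U x r"
proof -
  \<comment> \<open>Modulo \<open>cheb_U x n\<close> the two parts at index \<open>2 * n\<close> are
    1 and 0, so \<open>2 * n\<close> is a period.\<close>
  have T: "cheb_T x (2 * n) = 1 + 2 * ((x\<^sup>2 - 1) * (cheb_U x n)\<^sup>2)"
    using cheb_T_double[of x n] cheb_pell[of x n] by linarith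
  have "cheb_U x (r + 2 * n) - cheb_U x r
      = cheb_U x n * (2 * (x\<^sup>2 - 1) * cheb_U x n * cheb_U x r + 2 * cheb_T x n * cheb_T x r)"
    unfolding cheb_U_add cheb_U_double T by (simp add: power2_eq_square algebra_simps)
  then show ?thesis by simp
qed

text \<open>\<open>2 * n\<close> is a period modulo \<open>cheb_U x n\<close>, and
  \<open>cheb_U\<close> extends to negative indices as an odd function.\<close>

lemma cheb_U_reflect:
  assumes "k + r = 2 * n"
  shows "cheb_U x n dvd cheb_U x k + cheb_U x r"
proof -
  have T: "cheb_T x (k + r) = 1 + 2 * ((x\<^sup>2 - 1) * (cheb_U x n)\<^sup>2)"
    unfolding assms using cheb_T_double[of x n] cheb_pell[of x n] by linarith
  have U: "cheb_U x (k + r) = 2 * cheb_T x n * cheb_U x n"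
    unfolding assms by (rule cheb_U_double)
  \<comment> \<open>The irrational part of the power with index \<open>k + r\<close> times the
    conjugate of the power with index \<open>r\<close>.\<close>
  have "cheb_U x (k + r) * cheb_T x r - cheb_T x (k + r) * cheb_U x r
      = cheb_U x k * ((cheb_T x r)\<^sup>2 - (x\<^sup>2 - 1) * (cheb_U x r)\<^sup>2)"
    unfolding cheb_U_add cheb_T_add by (simp add: power2_eq_square algebra_simps)
  then have "cheb_U x k = cheb_U x (k + r) * cheb_T x r - cheb_T x (k + r) * cheb_U x r"
    by (simp add: cheb_pell)
  then have "cheb_U x k + cheb_U x r
      = cheb_U x n * (2 * cheb_T x n * cheb_T x r - 2 * (x\<^sup>2 - 1) * cheb_U x n * cheb_U x r)"
    unfolding T U by (simp add: power2_eq_square algebra_simps)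
  then show ?thesis by simp
qed

lemma coprime_cong_left_int:
  fixes a b n :: int
  assumes "n dvd a - b" "coprime b n"
  shows "coprime a n"
  using assms by (metis cong_iff_dvd_diff cong_imp_coprime cong_sym)

text \<open>One step of the Euclidean algorithm on the indices: \<open>m\<close> is replaced by its
  distance to \<open>2 * n\<close>, which is again odd. The values follow by
  \<open>cheb_U_shift\<close> or \<open>cheb_U_reflect\<close>.\<close>

lemma jacobi_cheb_U_step:
  fixes m n :: nat
  assumes x: "even x" "x \<ge> 2"
    and mn: "odd m" "odd n" "coprime m n" "n < m" "n > 0"
    and IH: "\<And>r. odd r \<Longrightarrow> r < m \<Longrightarrow> coprime r n \<Longrightarrow>
      coprime (cheb_U x r) (cheb_U x n) \<and> jacobi (cheb_U x r) (cheb_U x n) = jacobi (int r) (int n)"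
  shows "coprime (cheb_U x m) (cheb_U x n) \<and> jacobi (cheb_U x m) (cheb_U x n) = jacobi (int m) (int n)"
proof -
  have pos: "cheb_U x n > 0" "odd (cheb_U x n)"
    using x mn cheb_U_pos[of x n] odd_cheb_U[of x n] by simp_all
  show ?thesis
  proof (cases "m > 2 * n")
    case True
    define r where "r = m - 2 * n"
    have m: "m = r + 2 * n" using True by (simp add: r_def)
    have r: "odd r" "r < m" using mn m by presburger+
    have "coprime r n"
    proof (rule coprimeI)
      fix d assume "d dvd r" "d dvd n"
      then have "d dvd m" unfolding m by (intro dvd_add dvd_mult)
      then show "is_unit d" using \<open>d dvd n\<close> by (rule coprime_common_divisor[OF mn(3)])
    qed
    note r = r this
    have d: "cheb_U x n dvd cheb_U x m - cheb_U x r" unfolding m by (rule cheb_U_shift)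
    have "jacobi (cheb_U x m) (cheb_U x n) = jacobi (cheb_U x r) (cheb_U x n)"
      using d pos by (intro jacobi_cong) (auto simp: cong_iff_dvd_diff)
    also have "\<dots> = jacobi (int r) (int n)" using IH r by blast
    also have "\<dots> = jacobi (int m) (int n)"
      using mn by (intro jacobi_cong) (auto simp: m cong_iff_dvd_diff)
    finally show ?thesis using coprime_cong_left_int[OF d] IH r by blast
  next
    case False
    define r where "r = 2 * n - m"
    have m: "m + r = 2 * n" using False by (simp add: r_def)
    have r1: "odd r" "r < m" using mn m by presburger+
    have "coprime r n"
    proof (rule coprimeI)
      fix d assume "d dvd r" "d dvd n"
      then have "d dvd m" using m dvd_add_left_iff[of d r m] dvd_mult[of d n 2] by simp
      then show "is_unit d" using \<open>d dvd n\<close> by (rule coprime_common_divisor[OF mn(3)])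
    qed
    note r = r1 this
    have d: "cheb_U x n dvd cheb_U x m - (- cheb_U x r)" using cheb_U_reflect[OF m, of x] by simp
    have "jacobi (cheb_U x m) (cheb_U x n) = jacobi (- 1 * cheb_U x r) (cheb_U x n)"
      using d pos by (intro jacobi_cong) (auto simp: cong_iff_dvd_diff)
    also have "\<dots> = jacobi (-1) (cheb_U x n) * jacobi (cheb_U x r) (cheb_U x n)"
      using pos by (rule jacobi_mult_left)
    \<comment> \<open>The reflection costs a symbol of -1 for the values and for the indices; these
      agree because value and index agree modulo 4.\<close>
    also have "jacobi (-1) (cheb_U x n) = jacobi (-1) (int n)"
      using pos mn x by (simp add: jacobi_minus_one odd_cheb_U_mod_4_iff)
    also have "jacobi (cheb_U x r) (cheb_U x n) = jacobi (int r) (int n)" using IH r by blast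
    also have "jacobi (-1) (int n) * jacobi (int r) (int n) = jacobi (-1 * int r) (int n)"
      using mn by (intro jacobi_mult_left[symmetric]) auto
    also have "\<dots> = jacobi (int m) (int n)"
    proof (rule jacobi_cong)
      have "-1 * int r - int m = int n * -2" using m by linarith
      then show "[-1 * int r = int m] (mod int n)" by (simp only: cong_iff_dvd_diff dvd_triv_left)
    qed (use mn in auto)
    finally show ?thesis using coprime_cong_left_int[OF d] IH r by auto
  qed
qed

text \<open>Both symbols run through the same Euclidean algorithm, and reciprocity exchanges the
  entries with the same sign.\<close>

lemma jacobi_cheb_U:
  fixes m n :: nat
  assumes x: "even x" "x \<ge> 2" and "odd m" "odd n" "coprime m n"
  shows "coprime (cheb_U x m) (cheb_U x n) \<and> jacobi (cheb_U x m) (cheb_U x n) = jacobi (int m) (int n)"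
  using assms(3-5)
proof (induction "m + n" arbitrary: m n rule: less_induct)
  case less
  have mn: "m > 0" "n > 0" using less.prems by (auto intro!: Nat.gr0I)
  have pos: "cheb_U x k > 0" "odd (cheb_U x k)" if "odd k" for k
    using x that cheb_U_pos[of x k] odd_cheb_U[of x k] by (auto simp: odd_pos)
  \<comment> \<open>Equal indices are coprime only if both are 1.\<close>
  consider "m = 1" | "m > n" | "m < n" using less.prems by (cases m n rule: linorder_cases) auto
  then show ?case
  proof cases
    case 1
    then show ?thesis using less.prems mn pos[of n] by (simp add: jacobi_one_left)
  next
    case 2
    show ?thesis
      by (rule jacobi_cheb_U_step[OF x less.prems 2 mn(2)])
        (rule less.hyps; use less.prems in simp)
  next
    case 3
    have *: "coprime (cheb_U x n) (cheb_U x m) \<and> jacobi (cheb_U x n) (cheb_U x m) = jacobi (int n) (int m)"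
      by (rule jacobi_cheb_U_step[OF x less.prems(2,1) less.prems(3)[unfolded coprime_commute[of m]] 3 mn(1)])
        (rule less.hyps; use less.prems in simp)
    have "jacobi (cheb_U x m) (cheb_U x n) = jacobi (cheb_U x n) (cheb_U x m) *
        (if cheb_U x m mod 4 = 1 \<or> cheb_U x n mod 4 = 1 then 1 else -1)"
      using * pos less.prems by (intro jacobi_reciprocity) (auto simp: coprime_commute[of "cheb_U x m"])
    also have "\<dots> = jacobi (int n) (int m) * (if int m mod 4 = 1 \<or> int n mod 4 = 1 then 1 else -1)"
      using * less.prems x by (simp add: odd_cheb_U_mod_4_iff)
    also have "\<dots> = jacobi (int m) (int n)"
      using mn less.prems by (intro jacobi_reciprocity[symmetric]) (auto simp: coprime_int_iff)
    finally show ?thesis using * by (simp add: coprime_commute[of "cheb_U x m"])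
  qed
qed

section \<open>Square values of \<open>cheb_U\<close> at prime indices\<close>

lemma coprime_mult_eq_square:
  fixes a b c :: int
  assumes "coprime a b" "a \<ge> 0" "b \<ge> 0" "a * b = c\<^sup>2"
  obtains d e where "d \<ge> 0" "a = d\<^sup>2" "e \<ge> 0" "b = e\<^sup>2"
proof -
  have "coprime (nat a) (nat b)" using assms(1-3) by (simp add: coprime_int_iff[symmetric])
  moreover have "nat a * nat b = (nat \<bar>c\<bar>)\<^sup>2"
  proof -
    have "int (nat a * nat b) = int ((nat \<bar>c\<bar>)\<^sup>2)" using assms by simp
    then show ?thesis by (simp only: of_nat_eq_iff)
  qed
  then have "is_nth_power 2 (nat a * nat b)" by (auto intro: is_nth_powerI)
  ultimately have "is_nth_power 2 (nat a)" "is_nth_power 2 (nat b)"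
    using is_nth_power_mult_coprime_nat_iff by blast+
  then obtain d e where "nat a = d\<^sup>2" "nat b = e\<^sup>2" by (auto elim!: is_nth_powerE)
  then have "a = (int d)\<^sup>2" "b = (int e)\<^sup>2"
    using assms(2,3) by (metis int_nat_eq of_nat_power)+
  then show ?thesis using that[of "int d" "int e"] by simp
qed

text \<open>A primitive root \<open>g\<close> is a nonresidue: for a residue,
  \<open>g ^ ((p - 1) div 2)\<close> would be 1 modulo \<open>p\<close>, against the order of
  \<open>g\<close>.\<close>

lemma exists_odd_nonresidue:
  fixes p :: nat
  assumes "prime p" "odd p"
  shows "\<exists>m::nat. odd m \<and> coprime m p \<and> Legendre (int m) (int p) = -1"
proof -
  have p2: "p > 2" using assms prime_ge_2_nat[of p] by (cases "p = 2") auto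
  obtain g where g: "residue_primroot p g" using prime_primitive_root_exists[of p] assms p2 by auto
  then have ord: "ord p g = p - 1" and cop: "coprime p g"
    using assms by (auto simp: residue_primroot_def totient_prime)
  \<comment> \<open>\<open>jacobi_cheb_U\<close> needs an odd index; adding the odd \<open>p\<close>
    changes the parity but not the residue class.\<close>
  define m where "m = (if odd g then g else g + p)"
  have cong: "[int m = int g] (mod int p)" unfolding cong_iff_dvd_diff by (simp add: m_def)
  have "\<not> p dvd g" using cop p2 coprime_common_divisor[of p g p] by auto
  then have "\<not> [int g = 0] (mod int p)" unfolding cong_0_iff by simp
  moreover have "Legendre (int g) (int p) \<noteq> 1"
  proof
    assume "Legendre (int g) (int p) = 1"
    then have "[1 = int g ^ ((p - 1) div 2)] (mod int p)"
      using euler_criterion[OF assms(1) p2, of "int g"] by (simp only:)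
    from cong_sym[OF this] have "[int (g ^ ((p - 1) div 2)) = int 1] (mod int p)"
      by (simp only: of_nat_power of_nat_1)
    then have "[g ^ ((p - 1) div 2) = 1] (mod p)" by (simp only: cong_int_iff)
    then have "p - 1 dvd (p - 1) div 2" using ord ord_divides[of g "(p - 1) div 2" p] by simp
    then have "p - 1 \<le> (p - 1) div 2" using p2 by (intro dvd_imp_le) auto
    then show False using p2 by linarith
  qed
  ultimately have "Legendre (int m) (int p) = -1"
    unfolding Legendre_cong[OF cong] by (auto simp: Legendre_def)
  moreover have "coprime m p"
  proof (rule coprimeI)
    fix d assume d: "d dvd m" "d dvd p"
    then have "d dvd g" using dvd_add_left_iff[of d p g] by (cases "odd g") (simp_all add: m_def)
    with d(2) show "is_unit d" by (rule coprime_common_divisor[OF cop])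
  qed
  moreover have "odd m" using assms(2) by (simp add: m_def)
  ultimately show ?thesis by blast
qed

lemma cheb_U_dvd: "cheb_U x n dvd (cheb_T x n)\<^sup>2 - 1"
proof -
  have "(cheb_T x n)\<^sup>2 - 1 = cheb_U x n * ((x\<^sup>2 - 1) * cheb_U x n)"
    using cheb_pell[of x n] by (simp add: power2_eq_square algebra_simps)
  then show ?thesis by simp
qed

text \<open>A square as lower entry gives the symbol 1 for every coprime upper entry, but an index
  that is a nonresidue modulo \<open>p\<close> gives -1.\<close>

lemma cheb_U_odd_prime_not_square:
  assumes "even x" "x \<ge> 2" "prime p" "odd p"
  shows "cheb_U x p \<noteq> y\<^sup>2"
proof
  assume y: "cheb_U x p = y\<^sup>2"
  obtain m :: nat where m: "odd m" "coprime m p" "Legendre (int m) (int p) = -1"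
    using exists_odd_nonresidue assms by blast
  have U: "coprime (cheb_U x m) (cheb_U x p)" "jacobi (cheb_U x m) (cheb_U x p) = jacobi (int m) (int p)"
    using jacobi_cheb_U[OF assms(1,2) m(1) assms(4) m(2)] by auto
  have "odd (y\<^sup>2)" using odd_cheb_U[OF assms(1,4)] y by simp
  then have "\<bar>y\<bar> > 0" "odd \<bar>y\<bar>" by auto
  moreover have "coprime (cheb_U x m) \<bar>y\<bar>" using U(1) unfolding y by simp
  ultimately have "jacobi (cheb_U x m) (\<bar>y\<bar>\<^sup>2) = 1" by (rule jacobi_square)
  moreover have "jacobi (int m) (int p) = -1" using m assms by (simp add: jacobi_prime)
  ultimately show False using U y by simp
qed

section \<open>Indices at which \<open>cheb_T\<close> is a square\<close>

lemma even_cheb_T_iff: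
  assumes "even x"
  shows "even (cheb_T x n) \<longleftrightarrow> odd n" "even (cheb_U x n) \<longleftrightarrow> even n"
proof -
  have "(even (cheb_T x n) \<longleftrightarrow> odd n) \<and> (even (cheb_U x n) \<longleftrightarrow> even n)"
    using assms by (induction n) auto
  then show "even (cheb_T x n) \<longleftrightarrow> odd n" "even (cheb_U x n) \<longleftrightarrow> even n" by auto
qed

text \<open>For \<open>k\<close> odd \<open>cheb_T x (2 * k) = 2 * (cheb_T x k)\<^sup>2 - 1\<close> is \<open>-1\<close> modulo \<open>4\<close>.\<close>
lemma cheb_T_even_index_square:
  assumes "even x" "even n" "cheb_T x n = a\<^sup>2"
  shows "4 dvd n"
proof (rule ccontr)
  assume "\<not> 4 dvd n"
  then obtain k where n: "n = 2 * k" "odd k" using assms(2) by (elim evenE) auto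
  then obtain b where "cheb_T x k = 2 * b" using even_cheb_T_iff(1)[OF assms(1)] by (auto elim: evenE)
  then have a: "a\<^sup>2 = 8 * b\<^sup>2 - 1" using assms(3) n by (simp add: cheb_T_double power_mult_distrib)
  then have "odd (a\<^sup>2)" by simp
  then obtain d where "a = 2 * d + 1" by (auto elim: oddE)
  then have "4 * (d\<^sup>2 + d) + 2 = 8 * b\<^sup>2" using a by (simp add: power2_eq_square algebra_simps)
  then show False by presburger
qed

text \<open>Infinite descent from \<open>n\<close> to \<open>n div 4\<close>.\<close>
lemma cheb_even_index_squares:
  assumes "even x" "x \<ge> 2" "even n" "n > 0" "cheb_T x n = a\<^sup>2" "cheb_U x n = b\<^sup>2"
  shows False
  using assms(3-)
proof (induction n arbitrary: a b rule: less_induct)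
  case (less n)
  have x1: "x \<ge> 1" using assms by simp
  obtain k where n: "n = 2 * (2 * k)"
    using cheb_T_even_index_square[OF assms(1)] less.prems by (metis dvd_def mult.assoc mult_2 numeral_Bit0)
  have pos: "cheb_T x i \<ge> 0" "cheb_U x i \<ge> 0" for i using cheb_pos[OF x1, of i] by auto
  have odd: "odd (cheb_T x (2 * i))" for i using even_cheb_T_iff[OF assms(1)] by simp
  \<comment> \<open>The factor 2 stays with \<open>cheb_U\<close>: as \<open>cheb_T\<close> is odd
    at even indices, the two factors are coprime.\<close>
  have "cheb_T x (2 * k) * (2 * cheb_U x (2 * k)) = b\<^sup>2"
    using less.prems(4) unfolding n cheb_U_double[of x "2 * k"] by (simp only: ac_simps)
  moreover have "coprime (cheb_T x (2 * k)) (2 * cheb_U x (2 * k))"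
    using cheb_coprime odd by simp
  ultimately obtain u w where u: "cheb_T x (2 * k) = u\<^sup>2" and w: "2 * cheb_U x (2 * k) = w\<^sup>2"
    using pos coprime_mult_eq_square[of "cheb_T x (2 * k)" "2 * cheb_U x (2 * k)" b] by (metis mult_nonneg_nonneg zero_le_numeral)
  then have "4 dvd 2 * k" by (intro cheb_T_even_index_square[OF assms(1), of "2 * k" u]) auto
  then have k: "even k" by presburger
  \<comment> \<open>Since \<open>2 * cheb_U x (2 * k)\<close> is
    \<open>4 * cheb_T x k * cheb_U x k\<close>, halving \<open>w\<close> leaves a product of coprime
    factors at the smaller even index \<open>k\<close>.\<close>
  have "even (w\<^sup>2)" using w[symmetric] by simp
  then obtain v where "w = 2 * v" by (auto elim: evenE)
  then have "cheb_T x k * cheb_U x k = v\<^sup>2" using w by (simp add: cheb_U_double power_mult_distrib)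
  then obtain d e where "cheb_T x k = d\<^sup>2" "cheb_U x k = e\<^sup>2"
    using pos coprime_mult_eq_square[OF cheb_coprime] by metis
  then show False using less.IH[of k d e] less.prems n k by simp
qed

text \<open>If \<open>cheb_T (x\<^sup>2) p\<close> is a square \<open>a\<^sup>2\<close>, then \<open>a\<close> solves the Pell equation for
  \<open>x\<^sup>2 - 1\<close>, whose fundamental solution is \<open>(x, 1)\<close>, so \<open>a = cheb_T x w\<close>. Comparing the
  \<open>y\<close>-coordinates modulo \<open>x\<^sup>2 - 1\<close> gives \<open>p \<equiv> w\<close>, and comparing their sizes gives \<open>w < p\<close>.\<close>
lemma cheb_T_of_square_eq_square:
  assumes x: "even x" "x \<ge> 2" and p: "odd p" "p > 1" and a: "cheb_T (x\<^sup>2) p = a\<^sup>2"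
  shows "int p \<ge> x\<^sup>2 + 2"
proof -
  \<comment> \<open>\<open>E (x^2) k\<close> is the \<open>y\<close>-coordinate of the solution
    given by \<open>cheb_T_odd_minus_1\<close>, and \<open>cheb_U_odd_eq\<close> writes
    \<open>cheb_U x (2 * j + 1)\<close> as \<open>E (2 * x^2 - 1) j\<close>. Thus one function is
    compared at two arguments.\<close>
  define E where "E y k = cheb_U y (Suc k) + cheb_U y k" for y k
  have x4: "x\<^sup>2 \<ge> 4" using power_mono[of 2 x 2] x by simp
  obtain k where k: "p = 2 * k + 1" using p by (auto elim: oddE)
  have k0: "k > 0" using k p by simp
  have E_pos: "E (x\<^sup>2) k > 0"
    unfolding E_def using cheb_U_pos[of "x\<^sup>2" "Suc k"] cheb_pos[of "x\<^sup>2" k] x4 by (simp add: add_pos_nonneg)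
  have eq: "\<bar>a\<bar>\<^sup>2 - (x\<^sup>2 - 1) * (E (x\<^sup>2) k)\<^sup>2 = 1"
    using cheb_T_odd_minus_1[of "x\<^sup>2" k] a k unfolding E_def by simp
  have "a \<noteq> 0" using a cheb_pos[of "x\<^sup>2" p] x4 by auto
  then obtain w where w: "\<bar>a\<bar> = cheb_T x w" "E (x\<^sup>2) k = 1 * cheb_U x w"
    using pell_solutions[of "x\<^sup>2 - 1" x 1 "\<bar>a\<bar>" "E (x\<^sup>2) k"] eq E_pos x x4 by auto
  have "even (a\<^sup>2)" using even_cheb_T_iff(1)[of "x\<^sup>2" p] x p a by simp
  then have "even (cheb_T x w)" using w(1) by (metis dvd_abs_iff even_power)
  then have "odd w" using even_cheb_T_iff(1) x by blast
  then obtain j where j: "w = 2 * j + 1" by (elim oddE)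
  have EU: "E (x\<^sup>2) k = E (2 * x\<^sup>2 - 1) j" using w(2) unfolding j E_def cheb_U_odd_eq by simp
  have E_mono: "E y i \<le> E z i'" if "1 \<le> y" "y \<le> z" "i \<le> i'" for y z i i'
  proof -
    have "E y i \<le> E z i" unfolding E_def using cheb_mono[OF that(1,2)] by (intro add_mono) blast+
    also have "\<dots> \<le> E z i'" unfolding E_def
      using strict_mono_cheb_U[of z] that by (intro add_mono) (auto simp: strict_mono_less_eq simp del: cheb_U.simps)
    finally show ?thesis .
  qed
  have "j < k"
  proof (rule ccontr)
    assume "\<not> j < k"
    then have "E (2 * x\<^sup>2 - 1) k \<le> E (2 * x\<^sup>2 - 1) j" using x4 by (intro E_mono) auto
    moreover have "E (x\<^sup>2) k < E (2 * x\<^sup>2 - 1) k"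
      unfolding E_def
    proof (rule add_less_le_mono)
      show "cheb_U (x\<^sup>2) (Suc k) < cheb_U (2 * x\<^sup>2 - 1) (Suc k)"
        by (rule cheb_U_strict_mono_arg) (use x4 k0 in linarith)+
      show "cheb_U (x\<^sup>2) k \<le> cheb_U (2 * x\<^sup>2 - 1) k"
        by (rule cheb_mono[THEN conjunct2]) (use x4 in linarith)+
    qed
    ultimately show False using EU by simp
  qed
  moreover have "j > 0"
  proof (rule ccontr)
    assume "\<not> j > 0"
    then have "E (2 * x\<^sup>2 - 1) j = 1" by (simp add: E_def)
    moreover have "E (x\<^sup>2) k > 1" unfolding E_def
      using cheb_U_pos[of "x\<^sup>2" "Suc k"] cheb_U_pos[of "x\<^sup>2" k] k0 x4 by simp
    ultimately show False using EU by simp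
  qed
  moreover have "x\<^sup>2 - 1 dvd int p - int w"
  proof -
    have "x\<^sup>2 - 1 dvd cheb_U (x\<^sup>2) (Suc k) - int (Suc k)" "x\<^sup>2 - 1 dvd cheb_U (x\<^sup>2) k - int k"
      using cheb_U_cong_minus_1 by blast+
    from dvd_add[OF this] have p: "x\<^sup>2 - 1 dvd E (x\<^sup>2) k - int p"
      unfolding E_def k by (simp add: algebra_simps)
    have "int w = 2 * int j + 1" using j by simp
    then have "x\<^sup>2 - 1 dvd E (x\<^sup>2) k - int w"
      using odd_cheb_cong_sq_minus_1[of x j] w(2) by (simp only: j mult_1)
    from dvd_diff[OF this p] have "x\<^sup>2 - 1 dvd int p - int w" by simp
    then show ?thesis .
  qed
  \<comment> \<open>\<open>j < k\<close> makes \<open>p - w\<close> a positive multiple of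
    \<open>x^2 - 1\<close>, and \<open>j > 0\<close> makes \<open>w\<close> at least 3.\<close>
  ultimately have "x\<^sup>2 - 1 \<le> int p - int w" using j k by (intro zdvd_imp_le) auto
  then show ?thesis using \<open>j > 0\<close> j by simp
qed

section \<open>The only positive index at which both sequences are squares\<close>

lemma coprime_cheb_U_mult:
  assumes "odd p" "prime p" "\<not> int p dvd cheb_U x n"
  shows "coprime (cheb_U x n) (cheb_U (cheb_T x n) p)"
proof -
  obtain k where k: "p = 2 * k + 1" using assms by (auto elim: oddE)
  have "(cheb_T x n)\<^sup>2 - 1 dvd cheb_U (cheb_T x n) p - int p"
    using odd_cheb_cong_sq_minus_1[of "cheb_T x n" k] k by (simp add: add.commute)
  \<comment> \<open>So modulo \<open>cheb_U x n\<close> the second factor is \<open>p\<close>, and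
    only \<open>p\<close> could divide both.\<close>
  then have d: "cheb_U x n dvd cheb_U (cheb_T x n) p - int p" by (rule dvd_trans[OF cheb_U_dvd])
  have "coprime (int p) (cheb_U x n)" using assms by (intro prime_imp_coprime) auto
  then have "coprime (cheb_U (cheb_T x n) p) (cheb_U x n)" by (rule coprime_cong_left_int[OF d])
  then show ?thesis using coprime_commute by blast
qed

theorem cheb_squares_imp_index_1:
  assumes x: "even x" "x \<ge> 2" and n: "n > 0" and a: "cheb_T x n = a\<^sup>2" and b: "cheb_U x n = b\<^sup>2"
  shows "n = 1"
proof (rule ccontr)
  assume n1: "n \<noteq> 1"
  have odd_n: "odd n" using cheb_even_index_squares[OF x] n a b by blast
  obtain p where p: "prime p" "p dvd n" using n1 by (metis prime_factor_nat)
  then obtain r where r: "n = r * p" by (metis dvd_def mult.commute)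
  have odd: "odd p" "odd r" using odd_n r by auto
  have p3: "p \<ge> 3" using p odd prime_ge_2_nat[of p] by (cases "p = 2") auto
  define C where "C = cheb_T x r"
  have C: "even C" "C \<ge> 2"
    using even_cheb_T_iff(1)[OF x(1), of r] odd cheb_pos[of x r] x unfolding C_def by (auto elim!: evenE)
  have T: "cheb_T C p = a\<^sup>2" using a unfolding r cheb_T_mult C_def .
  have U: "cheb_U x r * cheb_U C p = b\<^sup>2" using b unfolding r cheb_U_mult C_def .
  have "int p dvd cheb_U x r"
  proof (rule ccontr)
    assume "\<not> int p dvd cheb_U x r"
    then have "coprime (cheb_U x r) (cheb_U C p)"
      unfolding C_def using p odd by (intro coprime_cheb_U_mult) auto
    then obtain e where "cheb_U C p = e\<^sup>2"
      using coprime_mult_eq_square[OF _ _ _ U] cheb_pos[of x r] cheb_pos[of C p] x C by auto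
    then show False using cheb_U_odd_prime_not_square[OF C p(1) odd(1)] by blast
  qed
  then have pC: "int p dvd C\<^sup>2 - 1"
    unfolding C_def using cheb_U_dvd dvd_trans by blast
  obtain k where k: "p = 2 * k + 1" using odd by (auto elim: oddE)
  \<comment> \<open>\<open>g = cheb_T C p / C\<close> is \<open>p\<close> up to sign modulo
    \<open>C\<close>, so it is coprime to \<open>C\<close> once \<open>p\<close> does not divide
    \<open>C\<close>. Since \<open>C * g\<close> is a square, so is \<open>C\<close>.\<close>
  have "C\<^sup>2 dvd cheb_T C p - (-1) ^ k * int p * C" using odd_cheb_cong_sq[of C k] k by (simp add: add.commute)
  then obtain h where "cheb_T C p = C * ((-1) ^ k * int p + C * h)"
    by (auto simp: dvd_def power2_eq_square algebra_simps)
  then obtain g where g: "cheb_T C p = C * g" "g = (-1) ^ k * int p + C * h" by blast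
  have "\<not> int p dvd C"
  proof
    assume "int p dvd C"
    then have "int p dvd C\<^sup>2" by (simp add: power2_eq_square)
    from dvd_diff[OF this pC] have "int p dvd 1" by simp
    then show False using p3 by simp
  qed
  then have "coprime (int p) C" using p by (intro prime_imp_coprime) auto
  then have "coprime ((-1) ^ k * int p) C" by (cases "even k") auto
  moreover have "C dvd g - (-1) ^ k * int p" using g(2) by simp
  ultimately have "coprime g C" using coprime_cong_left_int by blast
  then have "coprime C g" using coprime_commute by blast
  moreover have "C * g \<ge> 0" using g(1) cheb_pos[of C p] C by simp
  then have "g \<ge> 0" using C by (simp add: zero_le_mult_iff)
  ultimately obtain c where c: "C = c\<^sup>2" "c \<ge> 0"
    using coprime_mult_eq_square[of C g a] g T C by auto
  have "even c" using C(1) c by simp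
  moreover have "c \<ge> 2" using C c \<open>even c\<close> by (cases "c = 0") (auto elim!: evenE)
  \<comment> \<open>That is, \<open>p \<ge> C + 2\<close>, whereas \<open>p\<close> divides
    \<open>C - 1\<close> or \<open>C + 1\<close>.\<close>
  ultimately have "int p \<ge> c\<^sup>2 + 2"
    using cheb_T_of_square_eq_square[of c p a] T c odd p3 by simp
  moreover have "C\<^sup>2 - 1 = (C - 1) * (C + 1)" by (simp add: power2_eq_square algebra_simps)
  then have "int p dvd C - 1 \<or> int p dvd C + 1" using pC p(1) by (simp add: prime_dvd_mult_iff)
  then have "int p \<le> C + 1" using C zdvd_imp_le[of "int p" "C - 1"] zdvd_imp_le[of "int p" "C + 1"] by auto
  ultimately show False using c by simp
qed

text \<open>The bound \<open>s ^ 4 < 4 * D\<close> makes \<open>(c\<^sup>2, s\<^sup>2)\<close> the fundamental solution of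
  \<open>x\<^sup>2 - D * y\<^sup>2 = 1\<close>: a proper power of a solution \<open>(x, y)\<close> has \<open>y\<close>-coordinate at least
  \<open>2 * x > 2 * \<surd>D\<close>.\<close>
lemma pell_fundamental_solution:
  fixes c s D x y :: int
  assumes "D > 0" "c > 1" "s > 0" "c ^ 4 - D * s ^ 4 = 1" "s ^ 4 < 4 * D"
    and xy: "x > 0" "y > 0" "x\<^sup>2 - D * y\<^sup>2 = 1"
  shows "s\<^sup>2 \<le> y"
proof -
  define S where "S = (\<lambda>p::int \<times> int. fst p > 0 \<and> snd p > 0 \<and> (fst p)\<^sup>2 - D * (snd p)\<^sup>2 = 1)"
  have "S (x, y)" using xy by (simp add: S_def)
  then obtain p where p: "S p" "\<And>q. S q \<Longrightarrow> nat (snd p) \<le> nat (snd q)"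
    using ex_has_least_nat[of S "(x, y)" "\<lambda>p. nat (snd p)"] by blast
  obtain u v where uv: "p = (u, v)" by (cases p)
  have u: "u > 0" "v > 0" "u\<^sup>2 - D * v\<^sup>2 = 1" using p(1) uv by (auto simp: S_def)
  have min: "v \<le> y'" if "x' > 0" "y' > 0" "x'\<^sup>2 - D * y'\<^sup>2 = 1" for x' y'
    using p(2)[of "(x', y')"] that uv by (simp add: S_def)
  have "\<exists>n. c\<^sup>2 = cheb_T u n \<and> s\<^sup>2 = v * cheb_U u n"
    by (rule pell_solutions[OF assms(1) u min]) (use assms in simp_all)
  then obtain n where n: "c\<^sup>2 = cheb_T u n" "s\<^sup>2 = v * cheb_U u n" by blast
  have "s\<^sup>2 = v"
  proof (rule ccontr)
    assume "s\<^sup>2 \<noteq> v"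
    then have "n \<noteq> 1" using n by auto
    moreover have "n \<noteq> 0" using n(2) assms(3) by (cases n) auto
    ultimately have "n \<ge> 2" by linarith
    then have "cheb_U u 2 \<le> cheb_U u n"
      using strict_mono_cheb_U[of u] u by (simp add: strict_mono_less_eq)
    then have "2 * u \<le> cheb_U u n" by (simp only: cheb_U_2)
    also have "\<dots> \<le> v * cheb_U u n"
      using u cheb_pos[of u n] by (simp add: mult_le_cancel_right1)
    finally have "2 * u \<le> s\<^sup>2" using n by simp
    then have "(2 * u)\<^sup>2 \<le> (s\<^sup>2)\<^sup>2" using u by (intro power_mono) auto
    then have "4 * u\<^sup>2 \<le> s ^ 4" by simp
    moreover have "D * v\<^sup>2 \<ge> D" using u assms(1) by simp
    ultimately show False using u assms(5) by linarith
  qed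
  then show ?thesis using min[OF xy] by simp
qed

section \<open>The quartic Thue equation and the parameters of the family\<close>

theorem quartic_thue_unique:
  fixes a b c s D :: int
  assumes "D > 0" "even c" "c > 1" "s > 0" and cs: "c ^ 4 - D * s ^ 4 = 1" and "s ^ 4 < 4 * D"
    and ab: "a > 0" "b > 0" "a ^ 4 - D * b ^ 4 = 1"
  shows "a = c \<and> b = s"
proof -
  have fund: "s\<^sup>2 \<le> y" if "x > 0" "y > 0" "x\<^sup>2 - D * y\<^sup>2 = 1" for x y
    using pell_fundamental_solution[of D c s x y] assms that by blast
  \<comment> \<open>Read as a Pell solution, \<open>(a^2, b^2)\<close> is a power of the fundamental
    solution \<open>(c^2, s^2)\<close>.\<close>
  have "\<exists>n. a\<^sup>2 = cheb_T (c\<^sup>2) n \<and> b\<^sup>2 = s\<^sup>2 * cheb_U (c\<^sup>2) n"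
    by (rule pell_solutions[OF assms(1) _ _ _ fund]) (use assms in simp_all)
  then obtain n where n: "a\<^sup>2 = cheb_T (c\<^sup>2) n" "b\<^sup>2 = s\<^sup>2 * cheb_U (c\<^sup>2) n" by blast
  have n0: "n > 0" using n(2) ab by (cases n) auto
  \<comment> \<open>Cancelling \<open>s^2\<close> leaves the square \<open>d^2\<close>, so both
    Chebyshev values are squares.\<close>
  have "s\<^sup>2 dvd b\<^sup>2" using n(2) by simp
  then obtain d where d: "b = s * d" by auto
  then have "cheb_U (c\<^sup>2) n = d\<^sup>2" using n(2) assms(4) by (simp add: power_mult_distrib)
  moreover have "even (c\<^sup>2)" "c\<^sup>2 \<ge> 2"
    using assms(2,3) power_mono[of 2 c 2] by simp_all
  ultimately have "n = 1" using cheb_squares_imp_index_1[of "c\<^sup>2" n a d] n0 n(1) by simp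
  then have "a\<^sup>2 = c\<^sup>2" "b\<^sup>2 = s\<^sup>2" using n by simp_all
  then show ?thesis using assms by (simp add: power2_eq_iff)
qed

text \<open>As \<open>c - e = s ^ 4 * t\<close>, one gets
  \<open>m = t * (s ^ 4 * t + 2 * e) * (c^2 + 1)\<close>. For odd \<open>c\<close> both
  \<open>t * (s ^ 4 * t + 2 * e)\<close> and \<open>c^2 + 1\<close> are even and 4 would divide
  \<open>m\<close>; for even \<open>c\<close>, \<open>m\<close> is odd. The last bound comes from
  \<open>m \<ge> c^2 + 1\<close>.\<close>

lemma family_parameters:
  fixes s t e m c :: int
  assumes "s > 0" "t > 0" "e \<in> {1, -1}" and c: "c = s ^ 4 * t + e" and m: "m * s ^ 4 = c ^ 4 - 1"
    and "m > 1" "[m = 2] (mod 4) \<or> [m = 3] (mod 4)"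
  shows "even c" "c > 1" "m mod 4 = 3" "s ^ 4 < 4 * m"
proof -
  have s4: "s ^ 4 \<ge> 1" using assms(1) by simp
  have e2: "e\<^sup>2 = 1" using assms(3) by auto
  have "m * s ^ 4 = (c - e) * (c + e) * (c\<^sup>2 + 1)"
  proof -
    have "(c - e) * (c + e) * (c\<^sup>2 + 1) = (c\<^sup>2 - e\<^sup>2) * (c\<^sup>2 + 1)"
      by (simp add: algebra_simps power2_eq_square)
    also have "\<dots> = c ^ 4 - 1" unfolding e2 by (simp add: algebra_simps power4_eq_xxxx power2_eq_square)
    finally show ?thesis using m by simp
  qed
  also have "\<dots> = (t * (s ^ 4 * t + 2 * e) * (c\<^sup>2 + 1)) * s ^ 4"
    unfolding c by (simp add: algebra_simps)
  finally have m_eq: "m = (t * (s ^ 4 * t + 2 * e)) * (c\<^sup>2 + 1)" using assms(1) by simp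
  have m4: "m mod 4 = 2 \<or> m mod 4 = 3" using assms(7) by (auto simp: cong_def)
  show ev: "even c"
  proof (rule ccontr)
    assume c1: "odd c"
    have "even (t * (s ^ 4 * t + 2 * e))"
    proof (cases "even s")
      case False
      then have "even t" using c1 c assms(3) by auto
      then show ?thesis by simp
    qed auto
    moreover have "even (c\<^sup>2 + 1)" using c1 by simp
    ultimately have "2 * 2 dvd m" unfolding m_eq by (rule mult_dvd_mono)
    then show False using m4 by presburger
  qed
  have "s ^ 4 * 1 \<le> s ^ 4 * t" using s4 assms(2) by (intro mult_left_mono) auto
  then have cs: "c \<ge> s ^ 4 - 1" using c assms(3) by auto
  have "c \<noteq> 0"
  proof
    assume "c = 0"
    then have "m * s ^ 4 = -1" using m by simp
    moreover have "m * s ^ 4 > 0" using assms(1,6) by (intro mult_pos_pos) auto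
    ultimately show False by simp
  qed
  then show c1: "c > 1" using cs s4 ev by (cases "c = 1") auto
  have odd: "odd m"
  proof
    assume "even m"
    then have "even (c ^ 4 - 1)" unfolding m[symmetric] by simp
    then show False using ev by simp
  qed
  with m4 show "m mod 4 = 3" by presburger
  have "(t * (s ^ 4 * t + 2 * e)) * (c\<^sup>2 + 1) > 0" using m_eq assms(6) by linarith
  moreover have "c\<^sup>2 + 1 > 0" by (simp add: add_nonneg_pos)
  ultimately have "t * (s ^ 4 * t + 2 * e) > 0" by (rule zero_less_mult_pos2)
  then have "1 * (c\<^sup>2 + 1) \<le> m" unfolding m_eq by (intro mult_right_mono) auto
  moreover have "(s ^ 4 - 1) * 1 \<le> c * c" using cs c1 s4 by (intro mult_mono) auto
  ultimately show "s ^ 4 < 4 * m" using s4 by (simp add: power2_eq_square)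
qed

section \<open>Algebraic integers\<close>

context
begin

interpretation Z: Modules.module "\<lambda>(k::int) (x::'a::ring_1). of_int k * x"
  by (rule module_int)

text \<open>The determinant trick: \<open>z\<close> is an eigenvalue of an integer matrix.\<close>
lemma algebraic_int_if_stabilizes:
  fixes z :: "'a :: field_char_0"
  assumes B: "finite B" "b \<in> B" "b \<noteq> 0" and z: "\<And>b. b \<in> B \<Longrightarrow> z * b \<in> Z.span B"
  shows "algebraic_int z"
proof -
  obtain bs where bs: "set bs = B" "distinct bs" using finite_distinct_list[OF B(1)] by blast
  define n where "n = length bs"
  have "\<exists>u. z * b = (\<Sum>c\<in>B. of_int (u c) * c)" if "b \<in> B" for b
    using z[OF that] unfolding Z.span_finite[OF B(1)] by auto
  then obtain u where u: "\<And>b. b \<in> B \<Longrightarrow> z * b = (\<Sum>c\<in>B. of_int (u b c) * c)" by metis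
  define A where "A = mat n n (\<lambda>(i, j). u (bs ! i) (bs ! j))"
  define A' where "A' = map_mat (of_int :: int \<Rightarrow> 'a) A"
  define v where "v = vec n (\<lambda>i. bs ! i)"
  have A: "A \<in> carrier_mat n n" and A': "A' \<in> carrier_mat n n" by (auto simp: A_def A'_def)
  have "A' *\<^sub>v v = z \<cdot>\<^sub>v v"
  proof (rule eq_vecI)
    fix i assume "i < dim_vec (z \<cdot>\<^sub>v v)"
    then have i: "i < n" by (simp add: v_def)
    have "(A' *\<^sub>v v) $ i = (\<Sum>j<n. of_int (u (bs ! i) (bs ! j)) * bs ! j)"
      using i by (simp add: A'_def A_def v_def scalar_prod_def atLeast0LessThan)
    also have "\<dots> = (\<Sum>c\<in>B. of_int (u (bs ! i) c) * c)"
      using bs unfolding n_def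
      by (intro sum.reindex_bij_betw[of "\<lambda>j. bs ! j"]) (simp add: bij_betw_nth)
    also have "\<dots> = z * bs ! i"
      using u[symmetric] i bs(1) nth_mem[of i bs] by (simp add: n_def)
    finally show "(A' *\<^sub>v v) $ i = (z \<cdot>\<^sub>v v) $ i" using i by (simp add: v_def)
  qed (simp add: v_def A'_def A_def)
  moreover have "v \<noteq> 0\<^sub>v n"
  proof
    assume v0: "v = 0\<^sub>v n"
    obtain i where "i < n" "bs ! i = b" using B(2) bs(1) by (auto simp: in_set_conv_nth n_def)
    then have "v $ i = b" by (simp add: v_def)
    then show False using v0 \<open>i < n\<close> B(3) by simp
  qed
  moreover have "v \<in> carrier_vec n" by (simp add: v_def)
  ultimately have "eigenvalue A' z"
    using A' unfolding eigenvalue_def eigenvector_def by auto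
  then have "poly (char_poly A') z = 0" using eigenvalue_root_char_poly[OF A'] by simp
  moreover have "char_poly A' = map_poly of_int (char_poly A)"
    unfolding A'_def by (rule of_int_hom.char_poly_hom[OF A])
  moreover have "lead_coeff (char_poly A) = 1" using degree_monic_char_poly[OF A] by simp
  ultimately show ?thesis unfolding algebraic_int_altdef_ipoly by metis
qed

lemma algebraic_int_monic_relation:
  fixes x :: "'a :: field_char_0"
  assumes "algebraic_int x"
  obtains n where "n > 0" "x ^ n \<in> Z.span ((\<lambda>i. x ^ i) ` {..<n})"
proof -
  obtain p where p: "poly (map_poly of_int p) x = 0" "lead_coeff p = 1"
    using assms unfolding algebraic_int_altdef_ipoly by auto
  define n where "n = Polynomial.degree p"
  have d: "Polynomial.degree (map_poly of_int p :: 'a poly) = n"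
    using p(2) by (simp add: n_def)
  have "(\<Sum>i\<le>n. of_int (poly.coeff p i) * x ^ i) = 0"
    using p(1) unfolding poly_altdef d by (simp add: coeff_map_poly)
  also have "(\<Sum>i\<le>n. of_int (poly.coeff p i) * x ^ i) = (\<Sum>i<n. of_int (poly.coeff p i) * x ^ i) + x ^ n"
    using p(2) by (simp add: n_def lessThan_Suc_atMost[symmetric])
  finally have e: "x ^ n = - (\<Sum>i<n. of_int (poly.coeff p i) * x ^ i)"
    by (simp add: add_eq_0_iff)
  have "x ^ n \<in> Z.span ((\<lambda>i. x ^ i) ` {..<n})"
    unfolding e by (intro Z.span_neg Z.span_sum Z.span_scale Z.span_base) auto
  moreover have "n > 0"
  proof (rule ccontr)
    assume "\<not> n > 0"
    then show False using e by simp
  qed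
  ultimately show ?thesis using that by blast
qed

text \<open>The integer span of finitely many products \<open>x ^ i * y ^ j\<close> is stable under
  \<open>x\<close> and under \<open>y\<close>, hence under their sum and product.\<close>

lemma algebraic_int_ring:
  fixes x y :: "'a :: field_char_0"
  assumes "algebraic_int x" "algebraic_int y"
  shows "algebraic_int (x + y)" "algebraic_int (x * y)"
proof -
  obtain n where n: "n > 0" "x ^ n \<in> Z.span ((\<lambda>i. x ^ i) ` {..<n})"
    using algebraic_int_monic_relation[OF assms(1)] .
  obtain m where m: "m > 0" "y ^ m \<in> Z.span ((\<lambda>i. y ^ i) ` {..<m})"
    using algebraic_int_monic_relation[OF assms(2)] .
  define B where "B = (\<lambda>(i, j). x ^ i * y ^ j) ` ({..<n} \<times> {..<m})"
  have B: "finite B" "1 \<in> B"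
    using n(1) m(1) by (auto simp: B_def intro!: image_eqI[of _ _ "(0, 0)"])
  have BI: "x ^ i * y ^ j \<in> Z.span B" if "i < n" "j < m" for i j
    using that by (intro Z.span_base) (auto simp: B_def)
  have mult: "w * v \<in> Z.span B" if "v \<in> Z.span S" "\<And>s. s \<in> S \<Longrightarrow> w * s \<in> Z.span B" for w v S
    using that(1)
  proof (induction rule: Z.span_induct_alt)
    case (step c s v)
    have "w * (of_int c * s + v) = of_int c * (w * s) + w * v" by (simp add: algebra_simps)
    then show ?case using step that(2) by (simp add: Z.span_add Z.span_scale)
  qed (simp add: Z.span_zero)
  have xB: "x * b \<in> Z.span B" if b: "b \<in> B" for b
  proof -
    from b obtain i j where ij: "b = x ^ i * y ^ j" "i < n" "j < m" by (auto simp: B_def)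
    show ?thesis
    proof (cases "Suc i < n")
      case True
      then show ?thesis using BI[of "Suc i" j] ij by (simp add: mult.assoc)
    next
      case False
      then have "Suc i = n" using ij by simp
      \<comment> \<open>The exponent leaves the range of \<open>B\<close> here; the monic relation
        rewrites \<open>x ^ n\<close> by lower powers.\<close>
      then have "x * b = y ^ j * x ^ n" using ij by (simp flip: power_Suc add: mult_ac)
      also have "\<dots> \<in> Z.span B"
        by (rule mult[OF n(2)]) (use BI ij in \<open>auto simp: mult.commute\<close>)
      finally show ?thesis .
    qed
  qed
  have yB: "y * b \<in> Z.span B" if b: "b \<in> B" for b
  proof -
    from b obtain i j where ij: "b = x ^ i * y ^ j" "i < n" "j < m" by (auto simp: B_def)
    show ?thesis
    proof (cases "Suc j < m")
      case True
      then show ?thesis using BI[of i "Suc j"] ij by (simp add: mult_ac)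
    next
      case False
      then have "Suc j = m" using ij by simp
      then have "y * b = x ^ i * y ^ m" using ij by (simp flip: power_Suc add: mult_ac)
      also have "\<dots> \<in> Z.span B"
        by (rule mult[OF m(2)]) (use BI ij in auto)
      finally show ?thesis .
    qed
  qed
  show "algebraic_int (x + y)"
  proof (rule algebraic_int_if_stabilizes[OF B])
    fix b assume "b \<in> B"
    then show "(x + y) * b \<in> Z.span B"
      using Z.span_add[OF xB[of b] yB[of b]] by (simp add: distrib_right)
  qed simp
  show "algebraic_int (x * y)"
  proof (rule algebraic_int_if_stabilizes[OF B])
    fix b assume "b \<in> B"
    have "x * (y * b) \<in> Z.span B" by (rule mult[OF yB[OF \<open>b \<in> B\<close>] xB])
    then show "x * y * b \<in> Z.span B" by (simp add: mult.assoc)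
  qed simp
qed

end

section \<open>Subfields and quadratic extensions\<close>

lemma subfield_closed:
  assumes "is_subfield F"
  shows "0 \<in> F" "1 \<in> F" "\<And>x. x \<in> F \<Longrightarrow> - x \<in> F"
    "\<And>x y. x \<in> F \<Longrightarrow> y \<in> F \<Longrightarrow> x + y \<in> F" "\<And>x y. x \<in> F \<Longrightarrow> y \<in> F \<Longrightarrow> x - y \<in> F"
    "\<And>x y. x \<in> F \<Longrightarrow> y \<in> F \<Longrightarrow> x * y \<in> F" "\<And>x. x \<in> F \<Longrightarrow> inverse x \<in> F"
    "\<And>x y. x \<in> F \<Longrightarrow> y \<in> F \<Longrightarrow> x / y \<in> F"
proof -
  have one: "1 \<in> F" and diff: "\<And>x y. x \<in> F \<Longrightarrow> y \<in> F \<Longrightarrow> x - y \<in> F"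
    and mult: "\<And>x y. x \<in> F \<Longrightarrow> y \<in> F \<Longrightarrow> x * y \<in> F"
    and inv: "\<And>x. x \<in> F \<Longrightarrow> inverse x \<in> F"
    using assms by (auto simp: is_subfield_def)
  have zero: "0 \<in> F" using diff[OF one one] by simp
  have neg: "- x \<in> F" if "x \<in> F" for x using diff[OF zero that] by simp
  have add: "x + y \<in> F" if "x \<in> F" "y \<in> F" for x y using diff[OF that(1) neg[OF that(2)]] by simp
  have div: "x / y \<in> F" if "x \<in> F" "y \<in> F" for x y
    using mult[OF that(1) inv[OF that(2)]] by (simp add: divide_inverse)
  show "0 \<in> F" "1 \<in> F" "\<And>x. x \<in> F \<Longrightarrow> - x \<in> F"
    "\<And>x y. x \<in> F \<Longrightarrow> y \<in> F \<Longrightarrow> x + y \<in> F" "\<And>x y. x \<in> F \<Longrightarrow> y \<in> F \<Longrightarrow> x - y \<in> F"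
    "\<And>x y. x \<in> F \<Longrightarrow> y \<in> F \<Longrightarrow> x * y \<in> F" "\<And>x. x \<in> F \<Longrightarrow> inverse x \<in> F"
    "\<And>x y. x \<in> F \<Longrightarrow> y \<in> F \<Longrightarrow> x / y \<in> F"
    by (fact zero one neg add diff mult inv div)+
qed

lemma subfield_of_int: "is_subfield F \<Longrightarrow> of_int k \<in> F"
  by (induction k rule: int_induct[of _ 0]) (auto simp: subfield_closed)

lemma Rats_subset_subfield: "is_subfield F \<Longrightarrow> \<rat> \<subseteq> F"
  by (auto elim!: Rats_cases' intro!: subfield_closed subfield_of_int)

lemma is_subfield_Rats: "is_subfield \<rat>"
  by (auto simp: is_subfield_def)

text \<open>This is \<open>F(\<theta>)\<close> when \<open>\<theta>\<close> lies outside
  \<open>F\<close> and its square in \<open>F\<close>. Used twice, it builds the quartic field over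
  its quadratic subfield, so that traces and norms are taken one quadratic step at a time.\<close>

definition quadratic_ext :: "'a::field_char_0 set \<Rightarrow> 'a \<Rightarrow> 'a set" where
  "quadratic_ext F \<theta> = {a + b * \<theta> | a b. a \<in> F \<and> b \<in> F}"

lemma quadratic_extI: "a \<in> F \<Longrightarrow> b \<in> F \<Longrightarrow> a + b * \<theta> \<in> quadratic_ext F \<theta>"
  by (auto simp: quadratic_ext_def)

lemma quadratic_extE:
  assumes "x \<in> quadratic_ext F \<theta>"
  obtains a b where "a \<in> F" "b \<in> F" "x = a + b * \<theta>"
  using assms by (auto simp: quadratic_ext_def)

context
  fixes F :: "'a::field_char_0 set" and \<theta> :: 'a
  assumes F: "is_subfield F" and \<theta>: "\<theta> \<notin> F" "\<theta>\<^sup>2 \<in> F"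
begin

lemmas F_closed = subfield_closed[OF F]

lemma quadratic_ext_eq_0:
  assumes "a \<in> F" "b \<in> F" "a + b * \<theta> = 0"
  shows "a = 0" "b = 0"
proof -
  show "b = 0"
  proof (rule ccontr)
    assume "b \<noteq> 0"
    then have "\<theta> = - a / b" using assms(3) by (simp add: field_simps add_eq_0_iff)
    then show False using \<theta>(1) assms F_closed by auto
  qed
  then show "a = 0" using assms(3) by simp
qed

lemma quadratic_ext_unique:
  assumes "a \<in> F" "b \<in> F" "a' \<in> F" "b' \<in> F" "a + b * \<theta> = a' + b' * \<theta>"
  shows "a = a'" "b = b'"
  using quadratic_ext_eq_0[of "a - a'" "b - b'"] assms F_closed by (simp_all add: algebra_simps)

lemma is_subfield_quadratic_ext: "is_subfield (quadratic_ext F \<theta>)"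
  unfolding is_subfield_def
proof (intro conjI ballI)
  show "1 \<in> quadratic_ext F \<theta>" using quadratic_extI[of 1 F 0 \<theta>] F_closed by simp
  fix x assume "x \<in> quadratic_ext F \<theta>"
  then obtain a b where x: "a \<in> F" "b \<in> F" "x = a + b * \<theta>" by (rule quadratic_extE)
  define N where "N = a\<^sup>2 - b\<^sup>2 * \<theta>\<^sup>2"
  have N: "N \<in> F" unfolding N_def using x \<theta> F_closed by (simp add: power2_eq_square)
  \<comment> \<open>Rationalised by the conjugate \<open>a - b * \<theta>\<close>; for
    \<open>x = 0\<close> both sides are 0.\<close>
  have "inverse x = a / N + (- b / N) * \<theta>"
  proof (cases "x = 0")
    case True
    then show ?thesis using quadratic_ext_eq_0[of a b] x by simp
  next
    case False
    have "a - b * \<theta> \<noteq> 0"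
      using quadratic_ext_eq_0[of a "- b"] x False F_closed by auto
    moreover have "x * (a - b * \<theta>) = N" unfolding x N_def by (simp add: power2_eq_square algebra_simps)
    ultimately have "x * ((a - b * \<theta>) / N) = 1" using False by auto
    then have "inverse x = (a - b * \<theta>) / N" by (rule inverse_unique)
    then show ?thesis by (simp add: diff_divide_distrib)
  qed
  then show "inverse x \<in> quadratic_ext F \<theta>"
    using x N F_closed by (simp only:) (intro quadratic_extI F_closed)
  fix y assume "y \<in> quadratic_ext F \<theta>"
  then obtain c d where y: "c \<in> F" "d \<in> F" "y = c + d * \<theta>" by (rule quadratic_extE)
  have "x - y = (a - c) + (b - d) * \<theta>" unfolding x y by (simp add: algebra_simps)
  then show "x - y \<in> quadratic_ext F \<theta>" using x y by (simp only:) (intro quadratic_extI F_closed)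
  have "x * y = (a * c + b * d * \<theta>\<^sup>2) + (a * d + b * c) * \<theta>"
    unfolding x y by (simp add: power2_eq_square algebra_simps)
  then show "x * y \<in> quadratic_ext F \<theta>" using x y \<theta> by (simp only:) (intro quadratic_extI F_closed)
qed

text \<open>Conjugation over \<open>F\<close> expressed through polynomial values; it shows that
  conjugates are roots of the same polynomials.\<close>

lemma poly_conjugate:
  assumes "a \<in> F" "b \<in> F" "\<And>i. poly.coeff p i \<in> F"
  shows "\<exists>c\<in>F. \<exists>d\<in>F. poly p (a + b * \<theta>) = c + d * \<theta> \<and> poly p (a - b * \<theta>) = c - d * \<theta>"
  using assms(3)
proof (induction p)
  case 0
  then show ?case using F_closed by (intro bexI[of _ 0]) auto
next
  case (pCons k p)
  have "poly.coeff p i \<in> F" for i using pCons.prems[of "Suc i"] by simp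
  then obtain c d where cd: "c \<in> F" "d \<in> F"
    "poly p (a + b * \<theta>) = c + d * \<theta>" "poly p (a - b * \<theta>) = c - d * \<theta>"
    using pCons.IH by blast
  have k: "k \<in> F" using pCons.prems[of 0] by simp
  show ?case
  proof (intro bexI conjI)
    show "poly (pCons k p) (a + b * \<theta>) = (k + a * c + b * d * \<theta>\<^sup>2) + (a * d + b * c) * \<theta>"
      "poly (pCons k p) (a - b * \<theta>) = (k + a * c + b * d * \<theta>\<^sup>2) - (a * d + b * c) * \<theta>"
      unfolding poly_pCons cd by (simp_all add: power2_eq_square algebra_simps)
  qed (use cd k assms \<theta> in \<open>intro F_closed; simp\<close>)+
qed

lemma algebraic_int_conjugate:
  assumes "a \<in> F" "b \<in> F" "algebraic_int (a + b * \<theta>)"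
  shows "algebraic_int (a - b * \<theta>)"
  using assms(3)
proof cases
  case (1 p)
  have "poly.coeff p i \<in> F" for i
    using 1(2) subfield_of_int[OF F] by (auto elim!: Ints_cases dest: spec[of _ i])
  then obtain c d where cd: "c \<in> F" "d \<in> F"
    "poly p (a + b * \<theta>) = c + d * \<theta>" "poly p (a - b * \<theta>) = c - d * \<theta>"
    using poly_conjugate[OF assms(1,2)] by blast
  then have "c = 0" "d = 0" using quadratic_ext_eq_0[of c d] 1(3) by auto
  then show ?thesis using cd 1 by (intro algebraic_int.intros[of p]) auto
qed

lemma algebraic_int_trace_norm:
  assumes "a \<in> F" "b \<in> F" "algebraic_int (a + b * \<theta>)"
  shows "algebraic_int (2 * a)" "algebraic_int (a\<^sup>2 - b\<^sup>2 * \<theta>\<^sup>2)"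
proof -
  note c = algebraic_int_conjugate[OF assms]
  show "algebraic_int (2 * a)" using algebraic_int_ring(1)[OF assms(3) c] by simp
  have "(a + b * \<theta>) * (a - b * \<theta>) = a\<^sup>2 - b\<^sup>2 * \<theta>\<^sup>2" by (simp add: power2_eq_square algebra_simps)
  then show "algebraic_int (a\<^sup>2 - b\<^sup>2 * \<theta>\<^sup>2)" using algebraic_int_ring(2)[OF assms(3) c] by simp
qed

end

lemma algebraic_int_of_square:
  fixes x :: "'a :: field_char_0"
  assumes "algebraic_int (x\<^sup>2)"
  shows "algebraic_int x"
  using algebraic_int_root[of "x\<^sup>2" "Polynomial.monom 1 2" x] assms
  by (simp add: poly_monom degree_monom_eq coeff_monom)

section \<open>Pure quartic fields\<close>

lemma square_mod_4: "(x::int)\<^sup>2 mod 4 = (if even x then 0 else 1)"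
proof (cases "even x")
  case False
  then obtain y where "x = 2 * y + 1" by (elim oddE)
  then have "x\<^sup>2 = 4 * (y\<^sup>2 + y) + 1" by (simp add: power2_eq_square algebra_simps)
  then show ?thesis using False by presburger
qed (auto simp: power2_eq_square elim!: evenE)

text \<open>With \<open>g = gcd m u\<close>, the cofactor \<open>k\<close> of \<open>g\<close> in
  \<open>m\<close> is coprime to that in \<open>u\<close>. So \<open>k\<close> divides
  \<open>g\<close>, \<open>k^2\<close> divides \<open>m\<close>, and \<open>k\<close> is a
  unit.\<close>

lemma squarefree_dvd_square:
  fixes m u :: int
  assumes "squarefree m" "m \<noteq> 0" "m dvd u\<^sup>2"
  shows "m dvd u"
proof -
  define g where "g = gcd m u"
  have g0: "g \<noteq> 0" using assms(2) by (simp add: g_def)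
  obtain k w where kw: "m = g * k" "u = g * w" "coprime k w"
    using gcd_coprime_exists[of m u] g0 unfolding g_def by (metis mult.commute)
  have "g * k dvd g * (g * w\<^sup>2)" using assms(3) kw(1,2) by (simp add: power2_eq_square mult_ac)
  then have "k dvd g * w\<^sup>2" using g0 by simp
  moreover have "coprime k (w\<^sup>2)" using kw(3) by simp
  ultimately have "k dvd g" by (simp add: coprime_dvd_mult_left_iff)
  then have "k\<^sup>2 dvd m" unfolding kw(1) power2_eq_square by (intro mult_dvd_mono) auto
  then have "k dvd 1" by (rule squarefreeD[OF assms(1)])
  then have "g * k dvd g" by (metis dvd_refl mult_dvd_mono mult_1_right)
  then show ?thesis unfolding kw(1) kw(2) by (rule dvd_mult2)
qed

text \<open>The class \<open>m mod 4 = 3\<close> is the one left by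
  \<open>family_parameters\<close>; \<open>\<alpha>\<close> may be either real fourth root.\<close>

locale pure_quartic =
  fixes m :: int and \<alpha> :: real
  assumes m: "squarefree m" "m > 1" "m mod 4 = 3" and \<alpha>_pow_4: "\<alpha> ^ 4 = of_int m"
begin

definition r :: real where "r = \<alpha>\<^sup>2"

lemma r_sq: "r\<^sup>2 = of_int m"
  unfolding r_def using \<alpha>_pow_4 by simp

lemma r_notin_Rats: "r \<notin> \<rat>"
proof
  assume "r \<in> \<rat>"
  moreover have "algebraic_int (r\<^sup>2)" unfolding r_sq by (rule int_imp_algebraic_int) simp
  ultimately have "r \<in> \<int>" using algebraic_int_of_square rational_algebraic_int_is_int by blast
  then obtain k where k: "r = of_int k" by (elim Ints_cases)
  have "real_of_int (k\<^sup>2) = of_int m" using r_sq unfolding k by simp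
  then have "k\<^sup>2 = m" by (simp only: of_int_eq_iff)
  then have "k dvd 1" by (intro squarefreeD[OF m(1)]) simp
  then have "\<bar>k\<bar> = 1" by (simp only: zdvd1_eq)
  then have "k\<^sup>2 = 1" by (metis power2_abs one_power2)
  with \<open>k\<^sup>2 = m\<close> show False using m(2) by simp
qed

definition Qr :: "real set" where "Qr = quadratic_ext \<rat> r"

lemma r_sq_Rats: "r\<^sup>2 \<in> \<rat>"
  unfolding r_sq by simp

lemmas Qr_unique = quadratic_ext_unique[OF is_subfield_Rats r_notin_Rats r_sq_Rats]

lemma Qr: "is_subfield Qr"
  unfolding Qr_def by (rule is_subfield_quadratic_ext[OF is_subfield_Rats r_notin_Rats r_sq_Rats])

lemma Rats_Qr: "a \<in> \<rat> \<Longrightarrow> a \<in> Qr"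
  using Rats_subset_subfield[OF Qr] by blast

lemma r_Qr: "r \<in> Qr"
  unfolding Qr_def using quadratic_extI[of 0 \<rat> 1 r] by simp

text \<open>Squaring \<open>\<alpha> = a + b * r\<close> and comparing with \<open>r\<close> gives
  \<open>a^2 + m * b^2 = 0\<close> and \<open>2 * a * b = 1\<close>.\<close>

lemma \<alpha>_notin_Qr: "\<alpha> \<notin> Qr"
proof
  assume "\<alpha> \<in> Qr"
  then obtain a b where ab: "a \<in> \<rat>" "b \<in> \<rat>" "\<alpha> = a + b * r"
    unfolding Qr_def by (rule quadratic_extE)
  have "(a\<^sup>2 + b\<^sup>2 * of_int m) + (2 * a * b) * r = (a + b * r)\<^sup>2"
    unfolding r_sq[symmetric] by (simp add: power2_eq_square algebra_simps)
  also have "\<dots> = \<alpha>\<^sup>2" by (simp only: ab(3)[symmetric])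
  also have "\<dots> = 0 + 1 * r" by (simp add: r_def)
  finally have e: "(a\<^sup>2 + b\<^sup>2 * of_int m) + (2 * a * b) * r = 0 + 1 * r" .
  have "a\<^sup>2 + b\<^sup>2 * of_int m = 0" "2 * a * b = 1"
    using Qr_unique[OF _ _ _ _ e] ab by (auto simp: power2_eq_square)
  moreover have "b\<^sup>2 * of_int m \<ge> 0" using m(2) by simp
  ultimately have "a\<^sup>2 = 0" by (smt (verit) zero_le_power2)
  with \<open>2 * a * b = 1\<close> show False by simp
qed

lemma \<alpha>_sq_Qr: "\<alpha>\<^sup>2 \<in> Qr"
  using r_Qr by (simp add: r_def)

lemmas K_unique = quadratic_ext_unique[OF Qr \<alpha>_notin_Qr \<alpha>_sq_Qr]

lemma adjoin_eq: "adjoin \<alpha> = quadratic_ext Qr \<alpha>"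
proof
  show "adjoin \<alpha> \<subseteq> quadratic_ext Qr \<alpha>"
    unfolding adjoin_def
  proof (rule hull_minimal)
    show "{\<alpha>} \<subseteq> quadratic_ext Qr \<alpha>"
      using quadratic_extI[of 0 Qr 1 \<alpha>] subfield_closed[OF Qr] by simp
    show "is_subfield (quadratic_ext Qr \<alpha>)"
      by (rule is_subfield_quadratic_ext[OF Qr \<alpha>_notin_Qr \<alpha>_sq_Qr])
  qed
  have "quadratic_ext Qr \<alpha> \<subseteq> S" if S: "is_subfield S" "\<alpha> \<in> S" for S
  proof -
    note S_closed = subfield_closed[OF S(1)]
    have r: "r \<in> S" unfolding r_def power2_eq_square using S(2) by (intro S_closed(6))
    have "Qr \<subseteq> S"
    proof
      fix x assume "x \<in> Qr"
      then obtain a b where ab: "a \<in> \<rat>" "b \<in> \<rat>" "x = a + b * r"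
        unfolding Qr_def by (rule quadratic_extE)
      then have "a \<in> S" "b \<in> S" using Rats_subset_subfield[OF S(1)] by auto
      then show "x \<in> S" using r unfolding ab(3) by (intro S_closed(4,6))
    qed
    show ?thesis
    proof
      fix x assume "x \<in> quadratic_ext Qr \<alpha>"
      then obtain a b where ab: "a \<in> Qr" "b \<in> Qr" "x = a + b * \<alpha>" by (rule quadratic_extE)
      then have "a \<in> S" "b \<in> S" using \<open>Qr \<subseteq> S\<close> by auto
      then show "x \<in> S" using S(2) unfolding ab(3) by (intro S_closed(4,6))
    qed
  qed
  then show "quadratic_ext Qr \<alpha> \<subseteq> adjoin \<alpha>"
    unfolding adjoin_def hull_def by blast
qed

section \<open>Integers of the quadratic subfield and of the quartic field\<close>

lemma even_if_sum_squares:
  fixes a b :: int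
  assumes "4 dvd a\<^sup>2 - m * b\<^sup>2"
  shows "even a" "even b"
proof -
  define q where "q = m div 4"
  have mq: "m = 4 * q + 3" using m(3) unfolding q_def by presburger
  \<comment> \<open>Since \<open>- m\<close> is 1 modulo 4, the form becomes a sum of two
    squares.\<close>
  have "4 dvd (a\<^sup>2 - m * b\<^sup>2) + 4 * ((q + 1) * b\<^sup>2)" using assms by (intro dvd_add) simp_all
  also have "(a\<^sup>2 - m * b\<^sup>2) + 4 * ((q + 1) * b\<^sup>2) = a\<^sup>2 + b\<^sup>2"
    unfolding mq by (simp add: algebra_simps)
  finally have d: "4 dvd a\<^sup>2 + b\<^sup>2" .
  have "even a \<and> even b" using d square_mod_4[of a] square_mod_4[of b] by (cases "even a"; cases "even b") (simp_all, presburger+)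
  then show "even a" "even b" by auto
qed

text \<open>The left sides are the coordinates of the relative norm of
  \<open>(a + b * r) + (v + d * r) * \<alpha>\<close>. With \<open>m\<close> read as -1 modulo 4,
  parity pairs \<open>a\<close> with \<open>b\<close> and \<open>v\<close> with \<open>d\<close>;
  their squares then agree modulo 4, which leaves \<open>a * b\<close> and \<open>v * d\<close>
  even.\<close>

lemma coefficients_even:
  fixes a b v d e f :: int
  assumes "a\<^sup>2 + m * b\<^sup>2 - 2 * m * v * d = 4 * e" "2 * a * b - v\<^sup>2 - m * d\<^sup>2 = 4 * f"
  shows "even a \<and> even b \<and> even v \<and> even d"
proof -
  define q where "q = m div 4"
  have mq: "m = 4 * q + 3" using m(3) unfolding q_def by presburger
  have e1: "a\<^sup>2 - b\<^sup>2 + 2 * (v * d) = 4 * (e - b\<^sup>2 - q * b\<^sup>2 + 2 * q * v * d + 2 * v * d)"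
    using assms(1) unfolding mq by (simp add: algebra_simps)
  have e2: "2 * (a * b) - v\<^sup>2 + d\<^sup>2 = 4 * (f + d\<^sup>2 + q * d\<^sup>2)"
    using assms(2) unfolding mq by (simp add: algebra_simps)
  have vd: "even v \<longleftrightarrow> even d"
  proof -
    have "even (2 * (a * b) - v\<^sup>2 + d\<^sup>2)" unfolding e2 by simp
    then show ?thesis by simp
  qed
  then have "4 dvd d\<^sup>2 - v\<^sup>2"
    using square_mod_4[of v] square_mod_4[of d] by (metis mod_eq_dvd_iff)
  moreover have "4 dvd 2 * (a * b) - v\<^sup>2 + d\<^sup>2" unfolding e2 by simp
  ultimately have "4 dvd (2 * (a * b) - v\<^sup>2 + d\<^sup>2) - (d\<^sup>2 - v\<^sup>2)" by (rule dvd_diff[rotated])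
  then obtain k where "2 * (a * b) = 4 * k" by (auto elim: dvdE)
  then have "a * b = 2 * k" by linarith
  then have "even (a * b)" by simp
  moreover have "even a \<longleftrightarrow> even b"
  proof -
    have "even (a\<^sup>2 - b\<^sup>2 + 2 * (v * d))" unfolding e1 by simp
    then show ?thesis by simp
  qed
  ultimately have ab: "even a" "even b" by auto
  then have "4 dvd a\<^sup>2 - b\<^sup>2"
    using square_mod_4[of a] square_mod_4[of b] by (metis mod_eq_dvd_iff)
  moreover have "4 dvd a\<^sup>2 - b\<^sup>2 + 2 * (v * d)" unfolding e1 by simp
  ultimately have "4 dvd (a\<^sup>2 - b\<^sup>2 + 2 * (v * d)) - (a\<^sup>2 - b\<^sup>2)" by (rule dvd_diff[rotated])
  then obtain l where "2 * (v * d) = 4 * l" by (auto elim: dvdE)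
  then have "v * d = 2 * l" by linarith
  then have "even (v * d)" by simp
  with vd ab show ?thesis by auto
qed

text \<open>Trace and norm make \<open>2 * A\<close> and \<open>2 * B\<close> integers, and the norm
  equation modulo 4 makes both even.\<close>

lemma Qr_integers:
  assumes "A \<in> \<rat>" "B \<in> \<rat>" "algebraic_int (A + B * r)"
  shows "A \<in> \<int>" "B \<in> \<int>"
proof -
  have tr: "algebraic_int (2 * A)" and no: "algebraic_int (A\<^sup>2 - B\<^sup>2 * r\<^sup>2)"
    using algebraic_int_trace_norm[OF is_subfield_Rats r_notin_Rats r_sq_Rats assms] by auto
  have "2 * A \<in> \<int>" by (rule rational_algebraic_int_is_int[OF tr]) (use assms in auto)
  then obtain a where a: "2 * A = of_int a" by (elim Ints_cases)
  have "A\<^sup>2 - B\<^sup>2 * r\<^sup>2 \<in> \<int>"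
    by (rule rational_algebraic_int_is_int[OF no]) (use assms in \<open>auto simp: r_sq\<close>)
  then obtain n where n: "A\<^sup>2 - B\<^sup>2 * of_int m = of_int n" unfolding r_sq by (elim Ints_cases)
  have "2 * B \<in> \<rat>" using assms(2) by simp
  then obtain p q where pq: "q > 0" "coprime p q" "2 * B = of_int p / of_int q"
    by (rule Rats_cases')
  \<comment> \<open>With the denominator \<open>q\<close> of \<open>2 * B\<close> cleared, the norm
    equation shows that \<open>q^2\<close> divides the squarefree \<open>m\<close>.\<close>
  have "real_of_int (p\<^sup>2 * m) = (2 * B)\<^sup>2 * of_int m * of_int q ^ 2"
    using pq by (simp add: power_divide)
  also have "(2 * B)\<^sup>2 * of_int m = (2 * A)\<^sup>2 - 4 * of_int n"
    using n by (simp add: power_mult_distrib algebra_simps)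
  also have "((2 * A)\<^sup>2 - 4 * of_int n) * of_int q ^ 2 = real_of_int ((a\<^sup>2 - 4 * n) * q\<^sup>2)"
    unfolding a by simp
  finally have "p\<^sup>2 * m = (a\<^sup>2 - 4 * n) * q\<^sup>2" by (simp only: of_int_eq_iff)
  then have "q\<^sup>2 dvd p\<^sup>2 * m" by simp
  moreover have "coprime (q\<^sup>2) (p\<^sup>2)" using pq(2) by (simp add: coprime_commute)
  ultimately have "q\<^sup>2 dvd m" by (simp add: coprime_dvd_mult_right_iff)
  then have "q dvd 1" by (rule squarefreeD[OF m(1)])
  then have "q = 1" using pq(1) by (simp add: zdvd1_eq)
  then have b: "2 * B = of_int p" using pq by simp
  have "real_of_int (a\<^sup>2 - m * p\<^sup>2) = (2 * A)\<^sup>2 - of_int m * (2 * B)\<^sup>2" unfolding a b by simp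
  also have "\<dots> = real_of_int (4 * n)" using n by (simp add: power_mult_distrib algebra_simps)
  finally have "a\<^sup>2 - m * p\<^sup>2 = 4 * n" by (simp only: of_int_eq_iff)
  then have "even a" "even p" using even_if_sum_squares[of a p] by simp_all
  then obtain a' p' where "a = 2 * a'" "p = 2 * p'" by (auto elim!: evenE)
  then have "A = of_int a'" "B = of_int p'" using a b by simp_all
  then show "A \<in> \<int>" "B \<in> \<int>" by simp_all
qed

lemma Qr_algebraic_int_cases:
  assumes "x \<in> Qr" "algebraic_int x"
  obtains a b :: int where "x = of_int a + of_int b * r"
proof -
  obtain A B where AB: "A \<in> \<rat>" "B \<in> \<rat>" "x = A + B * r"
    using assms(1) unfolding Qr_def by (rule quadratic_extE)
  then have "A \<in> \<int>" "B \<in> \<int>" using Qr_integers assms(2) by auto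
  then show ?thesis using AB that by (auto elim!: Ints_cases)
qed

lemma Qr_int_unique:
  fixes a b c d :: int
  assumes "of_int a + of_int b * r = of_int c + of_int d * r"
  shows "a = c" "b = d"
  using Qr_unique[OF _ _ _ _ assms] by simp_all

definition elt :: "int \<Rightarrow> int \<Rightarrow> int \<Rightarrow> int \<Rightarrow> real" where
  "elt a b c d = of_int a + of_int b * \<alpha> + of_int c * \<alpha>\<^sup>2 + of_int d * \<alpha> ^ 3"

lemma elt_alt: "elt a b c d = (of_int a + of_int c * r) + (of_int b + of_int d * r) * \<alpha>"
  by (simp add: elt_def r_def power2_eq_square power3_eq_cube algebra_simps)

lemma algebraic_int_elt: "algebraic_int (elt a b c d)"
proof -
  have "algebraic_int (\<alpha> ^ 4)" unfolding \<alpha>_pow_4 by (rule int_imp_algebraic_int) simp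
  then have "algebraic_int ((\<alpha>\<^sup>2)\<^sup>2)" by simp
  then have \<alpha>: "algebraic_int \<alpha>" by (rule algebraic_int_of_square[OF algebraic_int_of_square])
  have i: "algebraic_int (of_int k :: real)" for k by (rule int_imp_algebraic_int) simp
  show ?thesis unfolding elt_def power2_eq_square power3_eq_cube
    by (intro algebraic_int_ring i \<alpha>)
qed

lemma elt_in_K: "elt a b c d \<in> adjoin \<alpha>"
  unfolding adjoin_eq elt_alt
  by (intro quadratic_extI subfield_closed[OF Qr] Rats_Qr r_Qr) simp_all

lemma ring_of_integers_subset:
  assumes "x \<in> ring_of_integers (adjoin \<alpha>)"
  obtains a b c d where "x = elt a b c d"
proof -
  have "x \<in> quadratic_ext Qr \<alpha>" and ai: "algebraic_int x"
    using assms by (auto simp: ring_of_integers_def adjoin_eq)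
  then obtain A B where AB: "A \<in> Qr" "B \<in> Qr" "x = A + B * \<alpha>" by (elim quadratic_extE)
  note cl = subfield_closed[OF Qr]
  have of_int_Qr: "\<And>k. of_int k \<in> Qr" by (rule subfield_of_int[OF Qr])
  have two: "2 \<in> Qr" using of_int_Qr[of 2] by simp
  have i: "algebraic_int (of_int k :: real)" for k by (rule int_imp_algebraic_int) simp
  have tr: "algebraic_int (2 * A)" and no: "algebraic_int (A\<^sup>2 - B\<^sup>2 * r)"
    using algebraic_int_trace_norm[OF Qr \<alpha>_notin_Qr \<alpha>_sq_Qr AB(1,2)] ai AB(3) by (auto simp: r_def)
  obtain a b where a: "2 * A = of_int a + of_int b * r"
    using Qr_algebraic_int_cases[OF cl(6)[OF two AB(1)] tr] .
  have "A\<^sup>2 - B\<^sup>2 * r \<in> Qr" unfolding power2_eq_square by (intro cl(5,6) AB r_Qr)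
  then obtain e f where e: "A\<^sup>2 - B\<^sup>2 * r = of_int e + of_int f * r"
    by (rule Qr_algebraic_int_cases[OF _ no])
  have ar: "algebraic_int r" using r_sq i[of m] by (intro algebraic_int_of_square[of r]) simp
  have M: "real_of_int m = r * r" using r_sq by (simp add: power2_eq_square)
  have B2: "(2 * B)\<^sup>2 * r = (2 * A)\<^sup>2 - 4 * (A\<^sup>2 - B\<^sup>2 * r)" by (simp add: power_mult_distrib)
  define g h where "g = a\<^sup>2 + b\<^sup>2 * m - 4 * e" and "h = 2 * a * b - 4 * f"
  have "(2 * B)\<^sup>2 * r = (of_int a + of_int b * r)\<^sup>2 - 4 * (of_int e + of_int f * r)"
    by (simp only: B2 a e)
  also have "\<dots> = of_int g + of_int h * r"
    unfolding g_def h_def by (simp add: M power2_eq_square algebra_simps)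
  finally have gh: "(2 * B)\<^sup>2 * r = of_int g + of_int h * r" .
  \<comment> \<open>Trace and norm control only \<open>(2 * B)^2 * r\<close>. One more factor
    \<open>r\<close> makes this the square of \<open>2 * B * r\<close>, which is therefore
    integral.\<close>
  have "(2 * B * r)\<^sup>2 = ((2 * B)\<^sup>2 * r) * r" by (simp add: power2_eq_square)
  also have "algebraic_int \<dots>" unfolding gh by (intro algebraic_int_ring i ar)
  finally have "algebraic_int (2 * B * r)" by (rule algebraic_int_of_square)
  then obtain u v where u: "2 * B * r = of_int u + of_int v * r"
    by (rule Qr_algebraic_int_cases[OF cl(6)[OF cl(6)[OF two AB(2)] r_Qr]])
  have "((2 * B)\<^sup>2 * r) * r = (2 * B * r)\<^sup>2" by (simp add: power2_eq_square)
  then have "of_int (h * m) + of_int g * r = of_int (u\<^sup>2 + v\<^sup>2 * m) + of_int (2 * u * v) * r"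
    unfolding gh u by (simp add: M power2_eq_square algebra_simps)
  then have "h * m = u\<^sup>2 + v\<^sup>2 * m" by (rule Qr_int_unique)
  \<comment> \<open>As \<open>m\<close> is squarefree, it divides \<open>u\<close>, so dividing
    \<open>u + v * r\<close> by \<open>r\<close> leaves the integer coordinates \<open>v\<close> and
    \<open>d\<close> for \<open>2 * B\<close>.\<close>
  then have "u\<^sup>2 = m * (h - v\<^sup>2)" by (simp add: algebra_simps)
  then have "m dvd u\<^sup>2" by simp
  then have "m dvd u" by (rule squarefree_dvd_square[rotated 2]) (use m in simp_all)
  then obtain d where d: "u = m * d" by (elim dvdE)
  have r0: "r \<noteq> 0" using r_notin_Rats by auto
  have "2 * B * r = (of_int v + of_int d * r) * r"
    unfolding u d by (simp add: M power2_eq_square algebra_simps)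
  then have c: "2 * B = of_int v + of_int d * r" using r0 by simp
  \<comment> \<open>Four times the relative norm, in the coordinates of \<open>2 * A\<close> and
    \<open>2 * B\<close>.\<close>
  have "of_int (a\<^sup>2 + m * b\<^sup>2 - 2 * m * v * d) + of_int (2 * a * b - v\<^sup>2 - m * d\<^sup>2) * r
      = (2 * A)\<^sup>2 - (2 * B)\<^sup>2 * r"
    unfolding a c by (simp add: M power2_eq_square algebra_simps)
  also have "\<dots> = of_int (4 * e) + of_int (4 * f) * r"
    using e by (simp add: power_mult_distrib algebra_simps)
  finally have "a\<^sup>2 + m * b\<^sup>2 - 2 * m * v * d = 4 * e" "2 * a * b - v\<^sup>2 - m * d\<^sup>2 = 4 * f"
    by (rule Qr_int_unique)+
  then have "even a \<and> even b \<and> even v \<and> even d" by (rule coefficients_even)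
  then obtain a' b' v' d' where "a = 2 * a'" "b = 2 * b'" "v = 2 * v'" "d = 2 * d'"
    by (auto elim!: evenE)
  then have "A = of_int a' + of_int b' * r" "B = of_int v' + of_int d' * r" using a c by simp_all
  then have "x = elt a' v' b' d'" unfolding AB elt_alt by simp
  then show ?thesis by (rule that)
qed

lemma ring_of_integers_iff:
  "x \<in> ring_of_integers (adjoin \<alpha>) \<longleftrightarrow> (\<exists>a b c d. x = elt a b c d)"
proof
  assume "x \<in> ring_of_integers (adjoin \<alpha>)"
  then show "\<exists>a b c d. x = elt a b c d" by (elim ring_of_integers_subset) blast
qed (auto simp: ring_of_integers_def algebraic_int_elt elt_in_K)

lemma elt_unique:
  assumes "elt a b c d = elt a' b' c' d'"
  shows "a = a'" "b = b'" "c = c'" "d = d'"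
proof -
  have Q: "of_int i + of_int j * r \<in> Qr" for i j
    by (intro subfield_closed[OF Qr] Rats_Qr r_Qr) simp_all
  have "of_int a + of_int c * r = of_int a' + of_int c' * r"
    "of_int b + of_int d * r = of_int b' + of_int d' * r"
    using K_unique[OF Q Q Q Q] assms unfolding elt_alt by blast+
  from this[THEN Qr_int_unique(1)] this[THEN Qr_int_unique(2)]
  show "a = a'" "b = b'" "c = c'" "d = d'" by simp_all
qed

end

section \<open>The index form\<close>

definition det3 :: "'a::comm_ring_1 \<Rightarrow> 'a \<Rightarrow> 'a \<Rightarrow> 'a \<Rightarrow> 'a \<Rightarrow> 'a \<Rightarrow> 'a \<Rightarrow> 'a \<Rightarrow> 'a \<Rightarrow> 'a" where
  "det3 a b c d e f g h i = a * (e * i - f * h) - b * (d * i - f * g) + c * (d * h - e * g)"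

lemma det3_mult:
  "det3 a1 a2 a3 b1 b2 b3 c1 c2 c3 * det3 x1 x2 x3 y1 y2 y3 z1 z2 z3
   = det3 (a1 * x1 + a2 * y1 + a3 * z1) (a1 * x2 + a2 * y2 + a3 * z2) (a1 * x3 + a2 * y3 + a3 * z3)
          (b1 * x1 + b2 * y1 + b3 * z1) (b1 * x2 + b2 * y2 + b3 * z2) (b1 * x3 + b2 * y3 + b3 * z3)
          (c1 * x1 + c2 * y1 + c3 * z1) (c1 * x2 + c2 * y2 + c3 * z2) (c1 * x3 + c2 * y3 + c3 * z3)"
  unfolding det3_def by (simp add: algebra_simps)

text \<open>The adjugate matrix applied to the system; without division, the coefficients stay in
  the ring.\<close>

lemma det3_cramer:
  assumes "v1 = a1 * u1 + a2 * u2 + a3 * u3" "v2 = b1 * u1 + b2 * u2 + b3 * u3"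
    "v3 = c1 * u1 + c2 * u2 + c3 * u3"
  shows "det3 a1 a2 a3 b1 b2 b3 c1 c2 c3 * u1
      = (b2 * c3 - b3 * c2) * v1 + (a3 * c2 - a2 * c3) * v2 + (a2 * b3 - a3 * b2) * v3"
    "det3 a1 a2 a3 b1 b2 b3 c1 c2 c3 * u2
      = (b3 * c1 - b1 * c3) * v1 + (a1 * c3 - a3 * c1) * v2 + (a3 * b1 - a1 * b3) * v3"
    "det3 a1 a2 a3 b1 b2 b3 c1 c2 c3 * u3
      = (b1 * c2 - b2 * c1) * v1 + (a2 * c1 - a1 * c2) * v2 + (a1 * b2 - a2 * b1) * v3"
  unfolding assms det3_def by (simp_all add: algebra_simps)

lemma det3_kernel:
  fixes a1 :: "'a :: idom"
  assumes "det3 a1 a2 a3 b1 b2 b3 c1 c2 c3 \<noteq> 0"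
    "i * a1 + j * b1 + k * c1 = 0" "i * a2 + j * b2 + k * c2 = 0" "i * a3 + j * b3 + k * c3 = 0"
  shows "i = 0" "j = 0" "k = 0"
proof -
  have t: "det3 a1 b1 c1 a2 b2 c2 a3 b3 c3 = det3 a1 a2 a3 b1 b2 b3 c1 c2 c3"
    unfolding det3_def by (simp add: algebra_simps)
  have "0 = a1 * i + b1 * j + c1 * k" "0 = a2 * i + b2 * j + c2 * k" "0 = a3 * i + b3 * j + c3 * k"
    using assms(2-4) by (simp_all add: mult.commute)
  from det3_cramer[OF this] show "i = 0" "j = 0" "k = 0"
    using assms(1) unfolding t by simp_all
qed

section \<open>Independence over the rationals and the degree\<close>

context pure_quartic
begin

lemma Qr_cases:
  assumes "x \<in> Qr"
  obtains p q where "x = of_rat p + of_rat q * r"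
  using assms unfolding Qr_def by (auto elim!: quadratic_extE Rats_cases)

lemma rational_independence:
  assumes "of_rat p0 + of_rat p1 * \<alpha> + of_rat p2 * \<alpha>\<^sup>2 + of_rat p3 * \<alpha> ^ 3 = 0"
  shows "p0 = 0" "p1 = 0" "p2 = 0" "p3 = 0"
proof -
  have Q: "of_rat p + of_rat q * r \<in> Qr" for p q
    by (intro subfield_closed[OF Qr] Rats_Qr r_Qr) simp_all
  have Q0: "0 \<in> Qr" by (rule subfield_closed[OF Qr])
  have "(of_rat p0 + of_rat p2 * r) + (of_rat p1 + of_rat p3 * r) * \<alpha> = 0 + 0 * \<alpha>"
    using assms by (simp add: r_def power2_eq_square power3_eq_cube algebra_simps)
  note K_unique[OF Q Q Q0 Q0 this]
  then have "of_rat p0 + of_rat p2 * r = 0 + 0 * r" "of_rat p1 + of_rat p3 * r = 0 + 0 * r" by simp_all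
  from Qr_unique[OF _ _ _ _ this(1)] Qr_unique[OF _ _ _ _ this(2)]
  show "p0 = 0" "p1 = 0" "p2 = 0" "p3 = 0" by simp_all
qed

lemma powers_distinct:
  "1 \<noteq> \<alpha>" "1 \<noteq> \<alpha>\<^sup>2" "1 \<noteq> \<alpha> ^ 3" "\<alpha> \<noteq> \<alpha>\<^sup>2" "\<alpha> \<noteq> \<alpha> ^ 3" "\<alpha>\<^sup>2 \<noteq> \<alpha> ^ 3"
  using rational_independence[of 1 "-1" 0 0] rational_independence[of 1 0 "-1" 0]
    rational_independence[of 1 0 0 "-1"] rational_independence[of 0 1 "-1" 0]
    rational_independence[of 0 1 0 "-1"] rational_independence[of 0 0 1 "-1"]
  by auto

end

context pure_quartic
begin

interpretation Q: Vector_Spaces.vector_space "\<lambda>(q::rat) (x::'a::field_char_0). of_rat q * x"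
  by (rule vector_space_rat)

text \<open>It fixes the exponents in \<open>generates_power_integral_basis\<close> as 0 to
  3.\<close>

lemma field_degree_adjoin: "field_degree (adjoin \<alpha>) = 4"
proof -
  define B where "B = {1, \<alpha>, \<alpha>\<^sup>2, \<alpha> ^ 3}"
  have card: "card B = 4" and fin: "finite B" using powers_distinct by (auto simp: B_def)
  have sub: "B \<subseteq> adjoin \<alpha>"
    using elt_in_K[of 1 0 0 0] elt_in_K[of 0 1 0 0] elt_in_K[of 0 0 1 0] elt_in_K[of 0 0 0 1]
    by (simp add: B_def elt_def)
  have "Q.independent B"
    unfolding Q.dependent_finite[OF fin]
  proof (intro notI, elim exE conjE bexE)
    fix u v assume *: "(\<Sum>v\<in>B. of_rat (u v) * v) = 0" "v \<in> B" "u v \<noteq> 0"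
    have "(\<Sum>v\<in>B. of_rat (u v) * v)
        = of_rat (u 1) + of_rat (u \<alpha>) * \<alpha> + of_rat (u (\<alpha>\<^sup>2)) * \<alpha>\<^sup>2 + of_rat (u (\<alpha> ^ 3)) * \<alpha> ^ 3"
      using powers_distinct by (simp add: B_def add.assoc)
    then have "u 1 = 0" "u \<alpha> = 0" "u (\<alpha>\<^sup>2) = 0" "u (\<alpha> ^ 3) = 0"
      using rational_independence *(1) by metis+
    then show False using *(2,3) by (auto simp: B_def)
  qed
  moreover have "Q.span B = Q.span (adjoin \<alpha>)"
  proof
    show "Q.span B \<subseteq> Q.span (adjoin \<alpha>)" using sub by (rule Q.span_mono)
    have "adjoin \<alpha> \<subseteq> Q.span B"
    proof
      fix x assume "x \<in> adjoin \<alpha>"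
      then obtain a b where ab: "a \<in> Qr" "b \<in> Qr" "x = a + b * \<alpha>"
        unfolding adjoin_eq by (rule quadratic_extE)
      obtain p q where a: "a = of_rat p + of_rat q * r" using ab(1) by (rule Qr_cases)
      obtain p' q' where b: "b = of_rat p' + of_rat q' * r" using ab(2) by (rule Qr_cases)
      have "x = of_rat p * 1 + of_rat p' * \<alpha> + of_rat q * \<alpha>\<^sup>2 + of_rat q' * \<alpha> ^ 3"
        unfolding ab a b r_def by (simp add: power2_eq_square power3_eq_cube algebra_simps)
      also have "\<dots> \<in> Q.span B"
        by (intro Q.span_add Q.span_scale Q.span_base) (auto simp: B_def)
      finally show "x \<in> Q.span B" .
    qed
    then show "Q.span (adjoin \<alpha>) \<subseteq> Q.span B" using Q.span_mono Q.span_span by blast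
  qed
  ultimately show ?thesis unfolding field_degree_def using Q.dim_eq_card card by metis
qed


end

section \<open>Arithmetic in coordinates and the index form\<close>

context pure_quartic
begin

lemma elt_add: "elt a b c d + elt a' b' c' d' = elt (a + a') (b + b') (c + c') (d + d')"
  by (simp add: elt_def algebra_simps)

lemma elt_mult: "elt a b c d * elt a' b' c' d'
    = elt (a * a' + m * (b * d' + c * c' + d * b')) (a * b' + b * a' + m * (c * d' + d * c'))
          (a * c' + b * b' + c * a' + m * (d * d')) (a * d' + b * c' + c * b' + d * a')"
proof -
  have M: "real_of_int m = \<alpha> ^ 4" by (simp add: \<alpha>_pow_4)
  show ?thesis
    unfolding elt_def by (simp add: M algebra_simps eval_nat_numeral)
qed

lemma elt_of_int: "of_int k = elt k 0 0 0"
  by (simp add: elt_def)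

lemma elt_of_int_mult: "of_int k * elt a b c d = elt (k * a) (k * b) (k * c) (k * d)"
  by (simp add: elt_def algebra_simps)

lemma elt_pow_2:
  "(elt 0 x y z)\<^sup>2 = elt (m * (y\<^sup>2 + 2 * x * z)) (2 * m * y * z) (x\<^sup>2 + m * z\<^sup>2) (2 * x * y)"
  unfolding power2_eq_square elt_mult by (simp add: algebra_simps)

lemma elt_pow_3:
  "(elt 0 x y z) ^ 3 = elt (m * (3 * x\<^sup>2 * y + 3 * m * y * z\<^sup>2)) (m * (3 * x * y\<^sup>2 + 3 * x\<^sup>2 * z + m * z ^ 3))
     (m * (6 * x * y * z + y ^ 3)) (x ^ 3 + 3 * m * x * z\<^sup>2 + 3 * m * y\<^sup>2 * z)"
proof -
  have "(elt 0 x y z) ^ 3 = elt 0 x y z * (elt 0 x y z)\<^sup>2" by (simp add: power3_eq_cube power2_eq_square)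
  then show ?thesis unfolding elt_pow_2 elt_mult
    by (simp add: algebra_simps power2_eq_square power3_eq_cube)
qed

text \<open>The determinant of \<open>\<beta>, \<beta>\<^sup>2, \<beta>\<^sup>3\<close> in terms of \<open>\<alpha>, \<alpha>\<^sup>2, \<alpha>\<^sup>3\<close>, where \<open>\<beta> = elt 0 x y z\<close>.\<close>
definition index_form :: "int \<Rightarrow> int \<Rightarrow> int \<Rightarrow> int" where
  "index_form x y z = det3 x y z (2 * m * y * z) (x\<^sup>2 + m * z\<^sup>2) (2 * x * y)
     (m * (3 * x * y\<^sup>2 + 3 * x\<^sup>2 * z + m * z ^ 3)) (m * (6 * x * y * z + y ^ 3))
     (x ^ 3 + 3 * m * x * z\<^sup>2 + 3 * m * y\<^sup>2 * z)"

lemma index_form_eq: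
  "index_form x y z = (x\<^sup>2 - m * z\<^sup>2) * ((x\<^sup>2 - m * z\<^sup>2)\<^sup>2 + 4 * m * (y\<^sup>2 - x * z)\<^sup>2)"
  unfolding index_form_def det3_def
  by (simp add: algebra_simps power2_eq_square power3_eq_cube)

definition poly_in :: "real \<Rightarrow> int \<Rightarrow> int \<Rightarrow> int \<Rightarrow> int \<Rightarrow> real" where
  "poly_in \<beta> i j k l = of_int i + of_int j * \<beta> + of_int k * \<beta>\<^sup>2 + of_int l * \<beta> ^ 3"

lemma poly_in_add:
  "poly_in \<beta> i j k l + poly_in \<beta> i' j' k' l' = poly_in \<beta> (i + i') (j + j') (k + k') (l + l')"
  by (simp add: poly_in_def algebra_simps)

lemma poly_in_scale: "of_int n * poly_in \<beta> i j k l = poly_in \<beta> (n * i) (n * j) (n * k) (n * l)"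
  by (simp add: poly_in_def algebra_simps)

lemma poly_in_shift:
  "poly_in (of_int w + \<beta>) i j k l
   = poly_in \<beta> (i + j * w + k * w\<^sup>2 + l * w ^ 3) (j + 2 * k * w + 3 * l * w\<^sup>2) (k + 3 * l * w) l"
  unfolding poly_in_def by (simp add: algebra_simps power2_eq_square power3_eq_cube)

lemma poly_in_elt:
  "poly_in (elt 0 x y z) i j k l = elt
     (i + k * (m * (y\<^sup>2 + 2 * x * z)) + l * (m * (3 * x\<^sup>2 * y + 3 * m * y * z\<^sup>2)))
     (j * x + k * (2 * m * y * z) + l * (m * (3 * x * y\<^sup>2 + 3 * x\<^sup>2 * z + m * z ^ 3)))
     (j * y + k * (x\<^sup>2 + m * z\<^sup>2) + l * (m * (6 * x * y * z + y ^ 3)))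
     (j * z + k * (2 * x * y) + l * (x ^ 3 + 3 * m * x * z\<^sup>2 + 3 * m * y\<^sup>2 * z))"
  unfolding poly_in_def elt_pow_2 elt_pow_3 elt_of_int_mult unfolding elt_of_int elt_add by simp

lemma index_form_unit_imp:
  assumes "index_form x y z dvd 1"
  shows "x\<^sup>2 - m * z\<^sup>2 = 1" "y\<^sup>2 = x * z"
proof -
  define N where "N = x\<^sup>2 - m * z\<^sup>2"
  have u: "N dvd 1" "N\<^sup>2 + 4 * m * (y\<^sup>2 - x * z)\<^sup>2 dvd 1"
    using dvd_mult_left dvd_mult_right assms unfolding index_form_eq N_def by blast+
  from u(1) have N: "N = 1 \<or> N = -1" by auto
  then have N2: "N\<^sup>2 = 1" by auto
  \<comment> \<open>The second factor is a unit and 1 plus a nonnegative term, so this term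
    vanishes.\<close>
  have "4 * m * (y\<^sup>2 - x * z)\<^sup>2 \<ge> 0" using m(2) by simp
  then have "4 * m * (y\<^sup>2 - x * z)\<^sup>2 = 0" using u(2) N2 by auto
  then show "y\<^sup>2 = x * z" using m(2) by simp
  \<comment> \<open>Modulo 4, \<open>x^2 + 1\<close> is 1 or 2, while \<open>m * z^2\<close> is 0 or
    3.\<close>
  have "N \<noteq> -1"
  proof
    assume "N = -1"
    then have "x\<^sup>2 + 1 = m * z\<^sup>2" unfolding N_def by simp
    moreover have "m = 4 * (m div 4) + 3" using m(3) by presburger
    ultimately have "x\<^sup>2 + 1 = 4 * ((m div 4) * z\<^sup>2) + 3 * z\<^sup>2" by (metis mult.assoc distrib_right)
    then show False using square_mod_4[of x] square_mod_4[of z] by (cases "even x"; cases "even z") (simp_all, presburger+)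
  qed
  then show "x\<^sup>2 - m * z\<^sup>2 = 1" using N N_def by simp
qed

end

section \<open>Power integral bases and units of the index form\<close>

context pure_quartic
begin

interpretation Z: Modules.module "\<lambda>(k::int) (x::'a::ring_1). of_int k * x"
  by (rule module_int)

lemma span_powers:
  "Z.span ((\<lambda>i. \<gamma> ^ i) ` {..<4}) = {poly_in \<gamma> i j k l | i j k l. True}"
proof
  have G: "(\<lambda>i. \<gamma> ^ i) ` {..<4} = {1, \<gamma>, \<gamma>\<^sup>2, \<gamma> ^ 3}"
    by (auto simp: numeral_eq_Suc lessThan_Suc)
  show "Z.span ((\<lambda>i. \<gamma> ^ i) ` {..<4}) \<subseteq> {poly_in \<gamma> i j k l | i j k l. True}"
  proof (rule Z.span_minimal)
    have "1 = poly_in \<gamma> 1 0 0 0" "\<gamma> = poly_in \<gamma> 0 1 0 0" "\<gamma>\<^sup>2 = poly_in \<gamma> 0 0 1 0"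
      "\<gamma> ^ 3 = poly_in \<gamma> 0 0 0 1" by (simp_all add: poly_in_def)
    then show "(\<lambda>i. \<gamma> ^ i) ` {..<4} \<subseteq> {poly_in \<gamma> i j k l | i j k l. True}"
      unfolding G by blast
    show "Z.subspace {poly_in \<gamma> i j k l | i j k l. True}"
      unfolding Z.subspace_def
    proof (intro conjI ballI allI)
      have "0 = poly_in \<gamma> 0 0 0 0" by (simp add: poly_in_def)
      then show "0 \<in> {poly_in \<gamma> i j k l | i j k l. True}" by blast
      fix v assume "v \<in> {poly_in \<gamma> i j k l | i j k l. True}"
      then obtain i j k l where v: "v = poly_in \<gamma> i j k l" by blast
      show "of_int n * v \<in> {poly_in \<gamma> i j k l | i j k l. True}" for n
        unfolding v poly_in_scale by blast
      fix v' assume "v' \<in> {poly_in \<gamma> i j k l | i j k l. True}"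
      then obtain i' j' k' l' where v': "v' = poly_in \<gamma> i' j' k' l'" by blast
      show "v + v' \<in> {poly_in \<gamma> i j k l | i j k l. True}"
        unfolding v v' poly_in_add by blast
    qed
  qed
  show "{poly_in \<gamma> i j k l | i j k l. True} \<subseteq> Z.span ((\<lambda>i. \<gamma> ^ i) ` {..<4})"
  proof clarify
    fix i j k l
    have "poly_in \<gamma> i j k l = of_int i * 1 + of_int j * \<gamma> + of_int k * \<gamma>\<^sup>2 + of_int l * \<gamma> ^ 3"
      by (simp add: poly_in_def)
    also have "\<dots> \<in> Z.span {1, \<gamma>, \<gamma>\<^sup>2, \<gamma> ^ 3}"
      by (intro Z.span_add Z.span_scale Z.span_base) simp_all
    finally show "poly_in \<gamma> i j k l \<in> Z.span ((\<lambda>i. \<gamma> ^ i) ` {..<4})" unfolding G .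
  qed
qed

text \<open>If \<open>\<alpha>\<close> and its powers are integer combinations of the powers of the
  generator, the coefficient matrix is invertible over the integers.\<close>

lemma index_form_unit:
  assumes "ring_of_integers (adjoin \<alpha>) \<subseteq> Z.span ((\<lambda>i. elt w x y z ^ i) ` {..<4})"
  shows "index_form x y z dvd 1"
proof -
  have e: "elt w x y z = of_int w + elt 0 x y z" by (simp add: elt_def)
  have "\<exists>i j k l. elt a b c d = poly_in (elt 0 x y z) i j k l" for a b c d
  proof -
    have "elt a b c d \<in> ring_of_integers (adjoin \<alpha>)" unfolding ring_of_integers_iff by blast
    then have "elt a b c d \<in> {poly_in (elt w x y z) i j k l | i j k l. True}"
      using assms span_powers by blast
    then show ?thesis unfolding e poly_in_shift by blast
  qed
  note ex = this
  obtain i1 j1 k1 l1 where 1: "elt 0 1 0 0 = poly_in (elt 0 x y z) i1 j1 k1 l1" using ex by blast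
  obtain i2 j2 k2 l2 where 2: "elt 0 0 1 0 = poly_in (elt 0 x y z) i2 j2 k2 l2" using ex by blast
  obtain i3 j3 k3 l3 where 3: "elt 0 0 0 1 = poly_in (elt 0 x y z) i3 j3 k3 l3" using ex by blast
  \<comment> \<open>Constant coordinates are dropped; the remaining 3 by 3 matrices multiply to the
    identity.\<close>
  note u = elt_unique(2-4)[OF 1[unfolded poly_in_elt], symmetric]
    elt_unique(2-4)[OF 2[unfolded poly_in_elt], symmetric]
    elt_unique(2-4)[OF 3[unfolded poly_in_elt], symmetric]
  have "det3 j1 k1 l1 j2 k2 l2 j3 k3 l3 * index_form x y z = det3 1 0 0 0 1 0 0 0 1"
    unfolding index_form_def det3_mult u ..
  also have "\<dots> = 1" by (simp add: det3_def)
  finally show ?thesis by (metis dvd_triv_right)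
qed

text \<open>The index form is 1 here: a nonzero determinant gives independence, and Cramer's rule
  without denominators gives the span.\<close>

lemma generates_if_index_form_unit:
  assumes "x\<^sup>2 - m * z\<^sup>2 = 1" "y\<^sup>2 = x * z"
  shows "generates_power_integral_basis (adjoin \<alpha>) (elt w x y z)"
proof -
  define \<beta> where "\<beta> = elt 0 x y z"
  define \<gamma> where "\<gamma> = elt w x y z"
  define G where "G = (\<lambda>i. \<gamma> ^ i) ` {..<4::nat}"
  have \<gamma>: "\<gamma> = of_int w + \<beta>" by (simp add: \<gamma>_def \<beta>_def elt_def)
  have I: "index_form x y z = 1" unfolding index_form_eq using assms by simp
  have rel: "i = 0 \<and> j = 0 \<and> k = 0 \<and> l = 0" if "poly_in \<beta> i j k l = 0" for i j k l
  proof -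
    have e: "elt 0 0 0 0 = poly_in (elt 0 x y z) i j k l" using that by (simp add: elt_def \<beta>_def)
    note u = elt_unique[OF e[unfolded poly_in_elt], symmetric]
    have "j = 0" "k = 0" "l = 0"
      using det3_kernel[OF _ u(2-4)] I unfolding index_form_def by simp_all
    then show ?thesis using u(1) by simp
  qed
  have rel': "i = 0 \<and> j = 0 \<and> k = 0 \<and> l = 0" if "poly_in \<gamma> i j k l = 0" for i j k l
    using rel[OF that[unfolded \<gamma> poly_in_shift]] by auto
  \<comment> \<open>Distinctness lets the sum over the set \<open>G\<close> split into four
    terms.\<close>
  have dist: "1 \<noteq> \<gamma>" "1 \<noteq> \<gamma>\<^sup>2" "1 \<noteq> \<gamma> ^ 3" "\<gamma> \<noteq> \<gamma>\<^sup>2" "\<gamma> \<noteq> \<gamma> ^ 3" "\<gamma>\<^sup>2 \<noteq> \<gamma> ^ 3"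
    using rel'[of 1 "-1" 0 0] rel'[of 1 0 "-1" 0] rel'[of 1 0 0 "-1"] rel'[of 0 1 "-1" 0]
      rel'[of 0 1 0 "-1"] rel'[of 0 0 1 "-1"] by (auto simp: poly_in_def)
  have G: "G = {1, \<gamma>, \<gamma>\<^sup>2, \<gamma> ^ 3}"
    unfolding G_def by (auto simp: numeral_eq_Suc lessThan_Suc)
  have fin: "finite G" by (simp add: G_def)
  have "Z.independent G"
    unfolding Z.dependent_finite[OF fin]
  proof (intro notI, elim exE conjE bexE)
    fix u v assume *: "(\<Sum>v\<in>G. of_int (u v) * v) = 0" "v \<in> G" "u v \<noteq> 0"
    have "(\<Sum>v\<in>G. of_int (u v) * v) = poly_in \<gamma> (u 1) (u \<gamma>) (u (\<gamma>\<^sup>2)) (u (\<gamma> ^ 3))"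
      using dist by (simp add: G poly_in_def add.assoc)
    then have "u 1 = 0 \<and> u \<gamma> = 0 \<and> u (\<gamma>\<^sup>2) = 0 \<and> u (\<gamma> ^ 3) = 0"
      using rel' *(1) by metis
    then show False using *(2,3) by (auto simp: G)
  qed
  moreover have "Z.span G = ring_of_integers (adjoin \<alpha>)"
  proof
    have "poly_in \<gamma> i j k l \<in> ring_of_integers (adjoin \<alpha>)" for i j k l
      unfolding \<gamma> poly_in_shift unfolding \<beta>_def poly_in_elt ring_of_integers_iff by blast
    then show "Z.span G \<subseteq> ring_of_integers (adjoin \<alpha>)" unfolding G_def span_powers by blast
    have Zc: "of_int k \<in> Z.span G" for k
      using Z.span_scale[OF Z.span_base[of 1 G], of k] by (simp add: G)
    have \<beta>1: "\<beta> \<in> Z.span G"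
      using Z.span_diff[OF Z.span_base[of \<gamma> G] Zc[of w]] by (simp add: G \<gamma>)
    \<comment> \<open>Binomial expansions of the powers of \<open>\<gamma> - w\<close>.\<close>
    have "\<beta>\<^sup>2 = poly_in \<gamma> (w\<^sup>2) (-2 * w) 1 0" "\<beta> ^ 3 = poly_in \<gamma> (- (w ^ 3)) (3 * w\<^sup>2) (-3 * w) 1"
      unfolding \<gamma> poly_in_shift by (simp_all add: poly_in_def power2_eq_square power3_eq_cube)
    then have \<beta>23: "\<beta>\<^sup>2 \<in> Z.span G" "\<beta> ^ 3 \<in> Z.span G" unfolding G_def span_powers by blast+
    have v: "\<beta> = of_int x * \<alpha> + of_int y * \<alpha>\<^sup>2 + of_int z * \<alpha> ^ 3"
      "\<beta>\<^sup>2 - of_int (m * (y\<^sup>2 + 2 * x * z)) = of_int (2 * m * y * z) * \<alpha> + of_int (x\<^sup>2 + m * z\<^sup>2) * \<alpha>\<^sup>2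
        + of_int (2 * x * y) * \<alpha> ^ 3"
      "\<beta> ^ 3 - of_int (m * (3 * x\<^sup>2 * y + 3 * m * y * z\<^sup>2))
        = of_int (m * (3 * x * y\<^sup>2 + 3 * x\<^sup>2 * z + m * z ^ 3)) * \<alpha> + of_int (m * (6 * x * y * z + y ^ 3)) * \<alpha>\<^sup>2
        + of_int (x ^ 3 + 3 * m * x * z\<^sup>2 + 3 * m * y\<^sup>2 * z) * \<alpha> ^ 3"
      unfolding \<beta>_def elt_pow_2 elt_pow_3 unfolding elt_def by simp_all
    have hom: "det3 (of_int a1) (of_int a2) (of_int a3) (of_int b1) (of_int b2) (of_int b3)
        (of_int c1) (of_int c2) (of_int c3) = real_of_int (det3 a1 a2 a3 b1 b2 b3 c1 c2 c3)"
      for a1 a2 a3 b1 b2 b3 c1 c2 c3 by (simp add: det3_def)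
    have comb: "of_int p * v1 + of_int q * v2 + of_int t * v3 \<in> Z.span G"
      if "v1 \<in> Z.span G" "v2 \<in> Z.span G" "v3 \<in> Z.span G" for p q t v1 v2 v3
      by (intro Z.span_add Z.span_scale that)
    have vG: "\<beta>\<^sup>2 - of_int p \<in> Z.span G" "\<beta> ^ 3 - of_int p \<in> Z.span G" for p
      by (intro Z.span_diff \<beta>23 Zc)+
    note cr = det3_cramer[OF v, unfolded hom index_form_def[symmetric] I of_int_1 mult_1]
    have "\<alpha> \<in> Z.span G"
      unfolding cr(1) of_int_mult[symmetric] of_int_diff[symmetric] by (intro comb \<beta>1 vG)
    moreover have "\<alpha>\<^sup>2 \<in> Z.span G"
      unfolding cr(2) of_int_mult[symmetric] of_int_diff[symmetric] by (intro comb \<beta>1 vG)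
    moreover have "\<alpha> ^ 3 \<in> Z.span G"
      unfolding cr(3) of_int_mult[symmetric] of_int_diff[symmetric] by (intro comb \<beta>1 vG)
    ultimately have "elt a b c d \<in> Z.span G" for a b c d
      unfolding elt_def by (intro Z.span_add Z.span_scale Zc)
    then show "ring_of_integers (adjoin \<alpha>) \<subseteq> Z.span G"
      using ring_of_integers_iff by auto
  qed
  moreover have "\<gamma> \<in> ring_of_integers (adjoin \<alpha>)" unfolding \<gamma>_def ring_of_integers_iff by blast
  ultimately show ?thesis
    unfolding generates_power_integral_basis_def integral_basis_def field_degree_adjoin
      \<gamma>_def[symmetric] G_def[symmetric] by blast
qed

theorem generates_power_integral_basis_iff:
  "generates_power_integral_basis (adjoin \<alpha>) \<gamma> \<longleftrightarrow>
   (\<exists>w x y z. \<gamma> = elt w x y z \<and> x\<^sup>2 - m * z\<^sup>2 = 1 \<and> y\<^sup>2 = x * z)"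
proof
  assume g: "generates_power_integral_basis (adjoin \<alpha>) \<gamma>"
  then obtain w x y z where \<gamma>: "\<gamma> = elt w x y z"
    unfolding generates_power_integral_basis_def using ring_of_integers_iff by blast
  have "index_form x y z dvd 1"
    using g unfolding \<gamma> generates_power_integral_basis_def integral_basis_def field_degree_adjoin
    by (intro index_form_unit[of w]) blast
  then show "\<exists>w x y z. \<gamma> = elt w x y z \<and> x\<^sup>2 - m * z\<^sup>2 = 1 \<and> y\<^sup>2 = x * z"
    using index_form_unit_imp \<gamma> by blast
qed (use generates_if_index_form_unit in blast)

end

section \<open>Equivalence and the solutions of the index form equation\<close>

context pure_quartic
begin

lemma pib_equivalent_elt_iff:
  "pib_equivalent (adjoin \<alpha>) \<gamma> (elt 0 x y z) \<longleftrightarrow> (\<exists>w. \<gamma> = elt w x y z \<or> \<gamma> = elt w (- x) (- y) (- z))"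
    (is "?L \<longleftrightarrow> ?R")
proof
  assume ?L
  then have "\<gamma> + elt 0 x y z \<in> \<int> \<or> \<gamma> - elt 0 x y z \<in> \<int>" by (simp add: pib_equivalent_def)
  then obtain w where "\<gamma> + elt 0 x y z = of_int w \<or> \<gamma> - elt 0 x y z = of_int w"
    by (auto elim!: Ints_cases)
  then have "\<gamma> = elt w (- x) (- y) (- z) \<or> \<gamma> = elt w x y z" by (auto simp: elt_def algebra_simps)
  then show ?R by blast
next
  assume ?R
  then obtain w where w: "\<gamma> = elt w x y z \<or> \<gamma> = elt w (- x) (- y) (- z)" by blast
  then have "\<gamma> + elt 0 x y z = of_int w \<or> \<gamma> - elt 0 x y z = of_int w" by (auto simp: elt_def)
  moreover have "\<gamma> \<in> ring_of_integers (adjoin \<alpha>)" "elt 0 x y z \<in> ring_of_integers (adjoin \<alpha>)"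
    using w ring_of_integers_iff by blast+
  ultimately show ?L by (auto simp: pib_equivalent_def)
qed

end

text \<open>The first equation makes \<open>x\<close> and \<open>z\<close> coprime, so by the second
  their absolute values are squares \<open>a^2\<close> and \<open>b^2\<close>, and
  \<open>quartic_thue_unique\<close> applies unless \<open>z = 0\<close>. The signs of
  \<open>x\<close> and \<open>z\<close> agree because \<open>x * z\<close> is a square.\<close>

lemma index_form_solutions:
  fixes m c s x y z :: int
  assumes "m > 0" "even c" "c > 1" "s > 0" "c ^ 4 - m * s ^ 4 = 1" "s ^ 4 < 4 * m"
  shows "x\<^sup>2 - m * z\<^sup>2 = 1 \<and> y\<^sup>2 = x * z \<longleftrightarrow>
    (x, y, z) \<in> {(1, 0, 0), (-1, 0, 0), (c\<^sup>2, c * s, s\<^sup>2), (c\<^sup>2, - (c * s), s\<^sup>2),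
      (- c\<^sup>2, - (c * s), - s\<^sup>2), (- c\<^sup>2, c * s, - s\<^sup>2)}" (is "?L \<longleftrightarrow> ?R")
proof
  assume L: ?L
  show ?R
  proof (cases "z = 0")
    case True
    then show ?thesis using L by (auto simp: power2_eq_1_iff)
  next
    case False
    have x0: "x \<noteq> 0"
    proof
      assume "x = 0"
      then have "m * z\<^sup>2 = -1" using L by simp
      moreover have "m * z\<^sup>2 \<ge> 0" using assms(1) by simp
      ultimately show False by simp
    qed
    have "coprime x z"
    proof (rule coprimeI)
      fix d assume "d dvd x" "d dvd z"
      then have "d dvd x * x - m * z * z" by (intro dvd_diff[OF dvd_mult2 dvd_mult])
      then show "is_unit d" using L by (simp add: power2_eq_square mult.assoc)
    qed
    then have "coprime \<bar>x\<bar> \<bar>z\<bar>" by simp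
    moreover have "\<bar>x\<bar> * \<bar>z\<bar> = y\<^sup>2" using L by (metis abs_mult abs_power2)
    ultimately obtain a b where ab: "a \<ge> 0" "\<bar>x\<bar> = a\<^sup>2" "b \<ge> 0" "\<bar>z\<bar> = b\<^sup>2"
      using coprime_mult_eq_square[of "\<bar>x\<bar>" "\<bar>z\<bar>" y] by auto
    have pos: "a > 0" "b > 0" using ab x0 False by (auto simp: order.strict_iff_order)
    have "a ^ 4 = \<bar>x\<bar>\<^sup>2" "b ^ 4 = \<bar>z\<bar>\<^sup>2" unfolding ab by simp_all
    then have "a ^ 4 - m * b ^ 4 = 1" using L by simp
    then have "a = c \<and> b = s" using quartic_thue_unique[of m c s a b] assms pos by blast
    then have x: "x = c\<^sup>2 \<or> x = - c\<^sup>2" and z: "z = s\<^sup>2 \<or> z = - s\<^sup>2" using ab by (auto simp: abs_if split: if_splits)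
    have cs: "c\<^sup>2 > 0" "s\<^sup>2 > 0" using assms by simp_all
    have "x * z \<ge> 0" using L by (metis zero_le_power2)
    then have sgn: "x > 0 \<longleftrightarrow> z > 0" using x0 False by (auto simp: zero_le_mult_iff)
    have "y\<^sup>2 = (c * s)\<^sup>2"
      using L x z sgn cs by (auto simp: power_mult_distrib)
    then have "y = c * s \<or> y = - (c * s)" by (simp add: power2_eq_iff)
    then show ?thesis using x z sgn cs by auto
  qed
next
  assume ?R
  moreover have "(c\<^sup>2)\<^sup>2 - m * (s\<^sup>2)\<^sup>2 = 1" using assms(5) by simp
  ultimately show ?L by (auto simp: power_mult_distrib)
qed

theorem theorem3:
  fixes s t \<epsilon> m :: int and \<alpha> \<gamma> :: real and K :: "real set"
  assumes "s > 0" and "t > 0" and "\<epsilon> \<in> {1, -1}"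
    and "real_of_int m = real_of_int ((s ^ 4 * t + \<epsilon>) ^ 4 - 1) / real_of_int (s ^ 4)"
    and "squarefree m" and "m > 1" and "[m = 2] (mod 4) \<or> [m = 3] (mod 4)"
    and "\<alpha> = root 4 (real_of_int m)"
    and "K = adjoin \<alpha>"
  shows "generates_power_integral_basis K \<gamma> \<longleftrightarrow>
    (\<exists>(x, y, z) \<in> {(1, 0, 0),
                  ((s ^ 4 * t + \<epsilon>)\<^sup>2, (s ^ 4 * t + \<epsilon>) * s, s\<^sup>2),
                  ((s ^ 4 * t + \<epsilon>)\<^sup>2, - ((s ^ 4 * t + \<epsilon>) * s), s\<^sup>2)}.
       pib_equivalent K \<gamma> (of_int x * \<alpha> + of_int y * \<alpha>\<^sup>2 + of_int z * \<alpha> ^ 3))"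
proof -
  define c where "c = s ^ 4 * t + \<epsilon>"
  have "real_of_int (m * s ^ 4) = real_of_int (c ^ 4 - 1)"
    using assms(1,4) by (simp add: c_def)
  then have ms: "m * s ^ 4 = c ^ 4 - 1" by (simp only: of_int_eq_iff)
  note par = family_parameters[OF assms(1,2,3) c_def ms assms(6,7)]
  have "\<alpha> ^ 4 = real_of_int m" using assms(6,8) by (simp add: real_root_pow_pos2)
  then interpret pure_quartic m \<alpha>
    by unfold_locales (use assms(5,6) par in auto)
  have sol: "x\<^sup>2 - m * z\<^sup>2 = 1 \<and> y\<^sup>2 = x * z \<longleftrightarrow>
      (x, y, z) \<in> {(1, 0, 0), (-1, 0, 0), (c\<^sup>2, c * s, s\<^sup>2), (c\<^sup>2, - (c * s), s\<^sup>2),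
        (- c\<^sup>2, - (c * s), - s\<^sup>2), (- c\<^sup>2, c * s, - s\<^sup>2)}" for x y z
    using index_form_solutions[of m c s x z y] assms(1,6) par ms by auto
  have "generates_power_integral_basis K \<gamma> \<longleftrightarrow>
      (\<exists>w x y z. \<gamma> = elt w x y z \<and> (x, y, z) \<in> {(1, 0, 0), (-1, 0, 0), (c\<^sup>2, c * s, s\<^sup>2),
        (c\<^sup>2, - (c * s), s\<^sup>2), (- c\<^sup>2, - (c * s), - s\<^sup>2), (- c\<^sup>2, c * s, - s\<^sup>2)})"
    unfolding assms(9) generates_power_integral_basis_iff sol ..
  \<comment> \<open>The six triples form three pairs up to sign, and equivalence identifies the
    members of each pair.\<close>
  also have "\<dots> \<longleftrightarrow> (\<exists>(x, y, z) \<in> {(1, 0, 0), (c\<^sup>2, c * s, s\<^sup>2), (c\<^sup>2, - (c * s), s\<^sup>2)}.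
      \<exists>w. \<gamma> = elt w x y z \<or> \<gamma> = elt w (- x) (- y) (- z))"
    by auto
  also have "\<dots> \<longleftrightarrow> (\<exists>(x, y, z) \<in> {(1, 0, 0), (c\<^sup>2, c * s, s\<^sup>2), (c\<^sup>2, - (c * s), s\<^sup>2)}.
      pib_equivalent K \<gamma> (of_int x * \<alpha> + of_int y * \<alpha>\<^sup>2 + of_int z * \<alpha> ^ 3))"
    unfolding assms(9) pib_equivalent_elt_iff[symmetric] by (simp add: elt_def)
  finally show ?thesis unfolding c_def .
qed

end
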